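(* Let $\mathcal K$ be a separable Hilbert space. Any weighted multi-Toeplitz operator $T\in B(\mathcal K\otimes\bigotimes_{s=1}^kF^2(H_{n_s}))$ has a unique formal Fourier representation $$\varphi_T(\mathbf W,\mathbf W^* ):=\sum_{(\boldsymbol\alpha,\boldsymbol\beta)\in\mathcal J}A_{(\boldsymbol\alpha,\boldsymbol\beta)}\otimes\mathbf W_{\boldsymbol\alpha}\mathbf W_{\boldsymbol\beta}^*,$$ where $\{A_{(\boldsymbol\alpha,\boldsymbol\beta)}\}_{(\boldsymbol\alpha,\boldsymbol\beta)\in\mathcal J}$ are operators on $\mathcal K$ such that $$Tp=\varphi_T(\mathbf W,\mathbf W^* )p,\qquad p\in\mathcal P_{\mathcal K}.$$
   Context: Fix $k\in\mathbb N=\{1,2,\ldots\}$ and $\mathbf m=(m_1,\ldots,m_k)$, $\mathbf n=(n_1,\ldots,n_k)$ with $m_i,n_i\in\mathbb N$. For each $i$, $\mathbb F_{n_i}^+$ is the unital free semigroup with generators $g_1^i,\ldots,g_{n_i}^i$ and identity $g_0^i$; $|\alpha|$ is the length of $\alpha$. $F^2(H_{n_i})=\bigoplus_{p\ge0}H_{n_i}^{\otimes p}$ is the full Fock space of the Hilbert space $H_{n_i}$ with orthonormal basis $e_1^i,\ldots,e_{n_i}^i$; it has orthonormal basis $\{e_\alpha^i\}_{\alpha\in\mathbb F_{n_i}^+}$, $e^i_\alpha=e^i_{j_1}\otimes\cdots\otimes e^i_{j_p}$ for $\alpha=g^i_{j_1}\cdots g^i_{j_p}$, $e^i_{g_0^i}=1$.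 $\mathbf F_{\mathbf n}^+:=\mathbb F_{n_1}^+\times\cdots\times\mathbb F_{n_k}^+$ and $e_{\boldsymbol\alpha}:=e_{\alpha_1}^1\otimes\cdots\otimes e^k_{\alpha_k}$. Let $D_{i,j}e_\alpha^i:=\sqrt{\frac{|\alpha|+1}{|\alpha|+m_i}}\,e_\alpha^i$, $S_{i,j}f:=e_j^i\otimes f$, $W_{i,j}:=S_{i,j}D_{i,j}$ on $F^2(H_{n_i})$, and let $\mathbf W_{i,j}$ act on $\bigotimes_{s=1}^kF^2(H_{n_s})$ as $W_{i,j}$ on the $i$th factor and as the identity on the others; $\mathbf W_{i,\alpha}:=\mathbf W_{i,j_1}\cdots\mathbf W_{i,j_p}$ for $\alpha=g^i_{j_1}\cdots g^i_{j_p}$, $\mathbf W_{i,g_0^i}:=I$; $\mathbf W_{\boldsymbol\alpha}:=\mathbf W_{1,\alpha_1}\cdots\mathbf W_{k,\alpha_k}$. Put $b_{i,\alpha}^{(m_i)}:=\binom{|\alpha|+m_i-1}{m_i-1}$. For $\omega,\gamma\in\mathbb F_{n_i}^+$ write $\omega\ge_r\gamma$ if $\omega=\sigma\gamma$ for some $\sigma\in\mathbb F_{n_i}^+$, and then $\omega\backslash_r\gamma:=\sigma$. $\boldsymbol\omega,\boldsymbol\gamma\in\mathbf F_{\mathbf n}^+$ are comparable if for each $i$ either $\omega_i\ge_r\gamma_i$ or $\gamma_i\ge_r\omega_i$ (max and min of $\omega_i,\gamma_i$ refer to $\ge_r$). $\mathcal C$ is the set of all comparable pairs. $\mathcal J\subset\mathcal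 C$ is the set of $(\boldsymbol\sigma,\boldsymbol\beta)$ for which there are $s_i\in\mathbb Z$ with $|\sigma_i|=\max\{s_i,0\}$, $|\beta_i|=\max\{-s_i,0\}$ for all $i$. $\mathbf s:\mathcal C\to\mathcal J$ is $\mathbf s(\boldsymbol\omega,\boldsymbol\gamma):=(\boldsymbol\sigma,\boldsymbol\beta)$ with $\sigma_i:=\omega_i\backslash_r\gamma_i$ if $\omega_i\ge_r\gamma_i$ and $g_0^i$ otherwise, $\beta_i:=\gamma_i\backslash_r\omega_i$ if $\gamma_i\ge_r\omega_i$ and $g_0^i$ otherwise. $\tau_{(\boldsymbol\omega,\boldsymbol\gamma)}:=\prod_{i=1}^k\sqrt{b^{(m_i)}_{i,\min\{\omega_i,\gamma_i\}}/b^{(m_i)}_{i,\max\{\omega_i,\gamma_i\}}}$ for $(\boldsymbol\omega,\boldsymbol\gamma)\in\mathcal C$. An operator $T$ is weighted (right) multi-Toeplitz if there are operators $\{B_{(\boldsymbol\sigma,\boldsymbol\beta)}\}_{(\boldsymbol\sigma,\boldsymbol\beta)\in\mathcal J}\subset B(\mathcal K)$ such that for all $\boldsymbol\omega,\boldsymbol\gamma\in\mathbf F_{\mathbf n}^+$ and $x,y\in\mathcal K$, $\langle T(x\otimes e_{\boldsymbol\gamma}),y\otimes e_{\boldsymbol\omega}\rangle$ equals $\tau_{(\boldsymbol\omega,\boldsymbol\gamma)}\langle B_{\mathbf s(\boldsymbol\omega,\boldsymbol\gamma)}x,y\rangle$ if $(\boldsymbol\omega,\boldsymbol\gamma)\in\mathcal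 C$ and $0$ otherwise. $\mathcal P_{\mathcal K}$ is the linear span of the vectors $h\otimes e_{\boldsymbol\alpha}$, $h\in\mathcal K$, $\boldsymbol\alpha\in\mathbf F_{\mathbf n}^+$. A formal series $\varphi_T$ is applied to vectors of $\mathcal P_{\mathcal K}$ termwise: $\varphi_T(\mathbf W,\mathbf W^* )(x\otimes e_{\boldsymbol\gamma}):=\sum_{(\boldsymbol\alpha,\boldsymbol\beta)\in\mathcal J}A_{(\boldsymbol\alpha,\boldsymbol\beta)}x\otimes\mathbf W_{\boldsymbol\alpha}\mathbf W_{\boldsymbol\beta}^*e_{\boldsymbol\gamma}$, the series being required to converge in norm (its terms are pairwise orthogonal). *)

theory Defs
  imports "HOL-Analysis.Analysis" "HOL-Library.Sublist"
begin

section \<open>Complex Hilbert spaces\<close>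

text \<open>The inner product is linear in the first argument. The norm is the one of the underlying
  real inner product space, so \<open>norm x = sqrt (Re (cinner x x))\<close>.\<close>

class complex_inner = real_inner +
  fixes scaleC :: "complex \<Rightarrow> 'a \<Rightarrow> 'a"  (infixr \<open>*\<^sub>C\<close> 75)
    and cinner :: "'a \<Rightarrow> 'a \<Rightarrow> complex"
  assumes scaleC_add_right: "c *\<^sub>C (x + y) = c *\<^sub>C x + c *\<^sub>C y"
    and scaleC_add_left: "(c + d) *\<^sub>C x = c *\<^sub>C x + d *\<^sub>C x"
    and scaleC_scaleC: "c *\<^sub>C d *\<^sub>C x = (c * d) *\<^sub>C x"
    and scaleC_of_real: "complex_of_real r *\<^sub>C x = r *\<^sub>R x"
    and cinner_add_left: "cinner (x + y) z = cinner x z + cinner y z"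
    and cinner_scaleC_left: "cinner (c *\<^sub>C x) y = c * cinner x y"
    and cinner_commute: "cinner x y = cnj (cinner y x)"
    and inner_eq_Re_cinner: "inner x y = Re (cinner x y)"

class chilbert_space = complex_inner + complete_space

instantiation complex :: chilbert_space
begin

definition scaleC_complex :: "complex \<Rightarrow> complex \<Rightarrow> complex"
  where "scaleC_complex c x = c * x"

definition cinner_complex :: "complex \<Rightarrow> complex \<Rightarrow> complex"
  where "cinner_complex x y = x * cnj y"

instance
  by standard
    (simp_all add: scaleC_complex_def cinner_complex_def inner_complex_def algebra_simps
      scaleR_conv_of_real)

end

lemma scaleC_zero_left [simp]: "0 *\<^sub>C (x::'a::complex_inner) = 0"
  using scaleC_of_real[of 0 x] by simp

lemma scaleC_one [simp]: "1 *\<^sub>C (x::'a::complex_inner) = x"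
  using scaleC_of_real[of 1 x] by simp

lemma scaleC_zero_right [simp]: "c *\<^sub>C (0::'a::complex_inner) = 0"
  using scaleC_add_right[of c 0 0] by simp

definition bounded_clinear :: "('a::complex_inner \<Rightarrow> 'a) \<Rightarrow> bool"
  where "bounded_clinear A \<longleftrightarrow> bounded_linear A \<and> (\<forall>c x. A (c *\<^sub>C x) = c *\<^sub>C A x)"


section \<open>Square-summable families\<close>

text \<open>\<open>ell2 I\<close> is the Hilbert space of square-summable families indexed by \<open>I\<close> (as functions
  vanishing outside \<open>I\<close>) with values in a Hilbert space \<open>K\<close>. For scalar values it is the
  Hilbert space with orthonormal basis \<open>ket i\<close>, \<open>i \<in> I\<close>; for values in \<open>K\<close> it is the Hilbert
  tensor product of \<open>K\<close> with that space, with elementary tensors \<open>ktensor x u\<close>. The index set is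
  a term and not a type because it depends on numerical parameters; operators on \<open>ell2 I\<close> are
  functions whose values outside \<open>ell2 I\<close> are irrelevant.\<close>

definition ell2 :: "'i set \<Rightarrow> ('i \<Rightarrow> 'a::complex_inner) set"
  where "ell2 I = {f. (\<forall>i. i \<notin> I \<longrightarrow> f i = 0) \<and> (\<lambda>i. (norm (f i))\<^sup>2) summable_on I}"

definition ell2_inner :: "('i \<Rightarrow> 'a::complex_inner) \<Rightarrow> ('i \<Rightarrow> 'a) \<Rightarrow> complex"
  where "ell2_inner f g = (\<Sum>\<^sub>\<infinity>i. cinner (f i) (g i))"

definition ell2_norm :: "('i \<Rightarrow> 'a::complex_inner) \<Rightarrow> real"
  where "ell2_norm f = sqrt (\<Sum>\<^sub>\<infinity>i. (norm (f i))\<^sup>2)"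

definition bounded_op_on :: "'i set \<Rightarrow> (('i \<Rightarrow> 'a::complex_inner) \<Rightarrow> ('i \<Rightarrow> 'a)) \<Rightarrow> bool"
  where "bounded_op_on I T \<longleftrightarrow>
    (\<forall>f\<in>ell2 I. T f \<in> ell2 I) \<and>
    (\<forall>f\<in>ell2 I. \<forall>g\<in>ell2 I. T (\<lambda>i. f i + g i) = (\<lambda>i. T f i + T g i)) \<and>
    (\<forall>c. \<forall>f\<in>ell2 I. T (\<lambda>i. c *\<^sub>C f i) = (\<lambda>i. c *\<^sub>C T f i)) \<and>
    (\<exists>M. \<forall>f\<in>ell2 I. ell2_norm (T f) \<le> M * ell2_norm f)"

definition ell2_adjoint ::
    "'i set \<Rightarrow> (('i \<Rightarrow> 'a::complex_inner) \<Rightarrow> ('i \<Rightarrow> 'a)) \<Rightarrow> ('i \<Rightarrow> 'a) \<Rightarrow> ('i \<Rightarrow> 'a)"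
  where "ell2_adjoint I X g =
    (THE h. h \<in> ell2 I \<and> (\<forall>f\<in>ell2 I. ell2_inner (X f) g = ell2_inner f h))"

text \<open>Unconditional convergence in the norm of \<open>ell2\<close>; this is what \<open>has_sum\<close> unfolds to when the
  topology is given by \<open>ell2_norm\<close>.\<close>

definition ell2_has_sum :: "('j \<Rightarrow> 'i \<Rightarrow> 'a::complex_inner) \<Rightarrow> ('i \<Rightarrow> 'a) \<Rightarrow> 'j set \<Rightarrow> bool"
  where "ell2_has_sum u s J \<longleftrightarrow>
    ((\<lambda>F. ell2_norm (\<lambda>i. (\<Sum>j\<in>F. u j i) - s i)) \<longlongrightarrow> 0) (finite_subsets_at_top J)"

definition lspan :: "('i \<Rightarrow> 'a::complex_inner) set \<Rightarrow> ('i \<Rightarrow> 'a) set"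
  where "lspan S = {(\<lambda>i. \<Sum>v\<in>t. c v *\<^sub>C v i) | t c. finite t \<and> t \<subseteq> S}"

definition ket :: "'i \<Rightarrow> 'i \<Rightarrow> complex"
  where "ket i = (\<lambda>j. if j = i then 1 else 0)"

definition ktensor :: "'a::complex_inner \<Rightarrow> ('i \<Rightarrow> complex) \<Rightarrow> ('i \<Rightarrow> 'a)"
  where "ktensor x u = (\<lambda>i. u i *\<^sub>C x)"

text \<open>The operator \<open>A \<otimes> X\<close> on the algebraic tensor product, that is, on families \<open>p\<close> with finite
  support in \<open>I\<close>: such a \<open>p\<close> is the sum of the vectors \<open>ktensor (p i) (ket i)\<close>.\<close>

definition op_tensor ::
    "'i set \<Rightarrow> ('a::complex_inner \<Rightarrow> 'a) \<Rightarrow> (('i \<Rightarrow> complex) \<Rightarrow> ('i \<Rightarrow> complex)) \<Rightarrow>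
      ('i \<Rightarrow> 'a) \<Rightarrow> ('i \<Rightarrow> 'a)"
  where "op_tensor I A X p = (\<lambda>j. \<Sum>i | i \<in> I \<and> p i \<noteq> 0. ktensor (A (p i)) (X (ket i)) j)"

lemma op_tensor_ktensor_ket:
  assumes "i \<in> I" "A 0 = 0"
  shows "op_tensor I A X (ktensor x (ket i)) = ktensor (A x) (X (ket i))"
proof (cases "x = 0")
  case True
  then show ?thesis
    using assms by (simp add: op_tensor_def ktensor_def)
next
  case False
  then have "{j. j \<in> I \<and> ktensor x (ket i) j \<noteq> 0} = {i}"
    using assms by (auto simp: ktensor_def ket_def)
  then show ?thesis
    by (simp add: op_tensor_def) (simp add: ktensor_def ket_def)
qed


section \<open>Words and Fock spaces\<close>

text \<open>A word over the generators \<open>g_1, ..., g_n\<close> of the free semigroup is a list over \<open>{1..n}\<close>;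
  the product is concatenation and the identity \<open>g_0\<close> is the empty list.\<close>

type_synonym word = "nat list"
type_synonym multiword = "nat \<Rightarrow> word"

abbreviation words :: "nat \<Rightarrow> word set"
  where "words N \<equiv> lists {1..N}"

definition multiwords :: "nat \<Rightarrow> (nat \<Rightarrow> nat) \<Rightarrow> multiword set"
  where "multiwords k n = (\<Pi>\<^sub>E i\<in>{1..k}. words (n i))"

text \<open>The full Fock space over an \<open>N\<close>-dimensional Hilbert space is \<open>ell2 (words N)\<close>, with \<open>ket \<alpha>\<close>
  for \<open>e_\<alpha>\<close>: the \<open>p\<close>-th tensor power consists of the functions supported on words of length \<open>p\<close>.
  The tensor product of the \<open>k\<close> Fock spaces is \<open>ell2 (multiwords k n)\<close>, with the following
  elementary tensors.\<close>

definition fock_tensor ::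
    "nat \<Rightarrow> (nat \<Rightarrow> nat) \<Rightarrow> (nat \<Rightarrow> word \<Rightarrow> complex) \<Rightarrow> multiword \<Rightarrow> complex"
  where "fock_tensor k n f =
    (\<lambda>\<omega>. if \<omega> \<in> multiwords k n then \<Prod>i = 1..k. f i (\<omega> i) else 0)"

definition multi_basis :: "nat \<Rightarrow> (nat \<Rightarrow> nat) \<Rightarrow> multiword \<Rightarrow> multiword \<Rightarrow> complex"
  where "multi_basis k n \<alpha> = fock_tensor k n (\<lambda>i. ket (\<alpha> i))"

lemma multi_basis_eq_ket:
  assumes "\<alpha> \<in> multiwords k n"
  shows "multi_basis k n \<alpha> = ket \<alpha>"
proof
  fix \<omega>
  show "multi_basis k n \<alpha> \<omega> = ket \<alpha> \<omega>"
  proof (cases "\<omega> = \<alpha>")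
    case True
    then show ?thesis
      using assms by (simp add: multi_basis_def fock_tensor_def ket_def)
  next
    case False
    show ?thesis
    proof (cases "\<omega> \<in> multiwords k n")
      case True
      then obtain i where "i \<in> {1..k}" "\<omega> i \<noteq> \<alpha> i"
        using False assms unfolding multiwords_def by (metis PiE_ext)
      then have "(\<Prod>i = 1..k. ket (\<alpha> i) (\<omega> i)) = 0"
        by (intro prod_zero) (auto simp: ket_def)
      then show ?thesis
        using False by (simp add: multi_basis_def fock_tensor_def ket_def)
    qed (use False in \<open>simp add: multi_basis_def fock_tensor_def ket_def\<close>)
  qed
qed

definition fock_diag :: "nat \<Rightarrow> (word \<Rightarrow> complex) \<Rightarrow> (word \<Rightarrow> complex)"
  where "fock_diag M f =
    (\<lambda>\<alpha>. complex_of_real (sqrt ((real (length \<alpha>) + 1) / (real (length \<alpha>) + real M))) * f \<alpha>)"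

text \<open>Creation operator \<open>f \<mapsto> e_j \<otimes> f\<close>.\<close>

definition fock_shift :: "nat \<Rightarrow> (word \<Rightarrow> complex) \<Rightarrow> (word \<Rightarrow> complex)"
  where "fock_shift j f = (\<lambda>\<omega>. case \<omega> of [] \<Rightarrow> 0 | l # \<alpha> \<Rightarrow> if l = j then f \<alpha> else 0)"

definition fock_wshift :: "nat \<Rightarrow> nat \<Rightarrow> (word \<Rightarrow> complex) \<Rightarrow> (word \<Rightarrow> complex)"
  where "fock_wshift M j = fock_shift j \<circ> fock_diag M"

lemma fock_diag_ket:
  "fock_diag M (ket \<alpha>) =
    (\<lambda>\<omega>. complex_of_real (sqrt ((real (length \<alpha>) + 1) / (real (length \<alpha>) + real M))) * ket \<alpha> \<omega>)"
  by (auto simp: fock_diag_def ket_def)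

lemma fock_shift_ket: "fock_shift j (ket \<alpha>) = ket (j # \<alpha>)"
  by (auto simp: fock_shift_def ket_def fun_eq_iff split: list.splits)

text \<open>The operator acting as \<open>X\<close> on the \<open>i\<close>-th tensor factor and as the identity on the others:
  \<open>X\<close> is applied to the slices in the \<open>i\<close>-th coordinate.\<close>

definition ampliation ::
    "nat \<Rightarrow> ((word \<Rightarrow> complex) \<Rightarrow> (word \<Rightarrow> complex)) \<Rightarrow>
      (multiword \<Rightarrow> complex) \<Rightarrow> (multiword \<Rightarrow> complex)"
  where "ampliation i X f = (\<lambda>\<omega>. X (\<lambda>u. f (\<omega> (i := u))) (\<omega> i))"

definition mshift :: "(nat \<Rightarrow> nat) \<Rightarrow> nat \<Rightarrow> nat \<Rightarrow> (multiword \<Rightarrow> complex) \<Rightarrow> (multiword \<Rightarrow> complex)"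
  where "mshift m i j = ampliation i (fock_wshift (m i) j)"

definition mshift_word ::
    "(nat \<Rightarrow> nat) \<Rightarrow> nat \<Rightarrow> word \<Rightarrow> (multiword \<Rightarrow> complex) \<Rightarrow> (multiword \<Rightarrow> complex)"
  where "mshift_word m i \<alpha> = foldr (\<lambda>j X. mshift m i j \<circ> X) \<alpha> id"

definition mshift_multi ::
    "nat \<Rightarrow> (nat \<Rightarrow> nat) \<Rightarrow> multiword \<Rightarrow> (multiword \<Rightarrow> complex) \<Rightarrow> (multiword \<Rightarrow> complex)"
  where "mshift_multi k m \<alpha> = foldr (\<lambda>i X. mshift_word m i (\<alpha> i) \<circ> X) [1..<Suc k] id"

lemma mshift_fock_tensor:
  assumes "i \<in> {1..k}" "j \<in> {1..n i}"
  shows "mshift m i j (fock_tensor k n f) = fock_tensor k n (f(i := fock_wshift (m i) j (f i)))"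
proof
  fix \<omega> :: multiword
  define R where "R = (\<Prod>s\<in>{1..k} - {i}. f s (\<omega> s))"
  have split1: "(\<Prod>s = 1..k. f s ((\<omega> (i := \<alpha>)) s)) = f i \<alpha> * R" for \<alpha>
  proof -
    have "(\<Prod>s\<in>{1..k} - {i}. f s ((\<omega> (i := \<alpha>)) s)) = R"
      unfolding R_def by (intro prod.cong) auto
    then show ?thesis
      using assms(1) prod.remove[of "{1..k}" i "\<lambda>s. f s ((\<omega> (i := \<alpha>)) s)"] by simp
  qed
  have split2: "(\<Prod>s = 1..k. (f(i := g)) s (\<omega> s)) = g (\<omega> i) * R" for g
  proof -
    have "(\<Prod>s\<in>{1..k} - {i}. (f(i := g)) s (\<omega> s)) = R"
      unfolding R_def by (intro prod.cong) auto
    then show ?thesis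
      using assms(1) prod.remove[of "{1..k}" i "\<lambda>s. (f(i := g)) s (\<omega> s)"] by simp
  qed
  show "mshift m i j (fock_tensor k n f) \<omega> =
      fock_tensor k n (f(i := fock_wshift (m i) j (f i))) \<omega>"
  proof (cases "\<exists>\<alpha>. \<omega> i = j # \<alpha>")
    case False
    then have "fock_wshift (m i) j g (\<omega> i) = 0" for g
      by (auto simp: fock_wshift_def fock_shift_def split: list.splits)
    then show ?thesis
      unfolding mshift_def ampliation_def fock_tensor_def split2 by simp
  next
    case True
    then obtain \<alpha> where \<alpha>: "\<omega> i = j # \<alpha>"
      by blast
    have mem: "\<omega> (i := \<alpha>) \<in> multiwords k n \<longleftrightarrow> \<omega> \<in> multiwords k n"
    proof
      assume "\<omega> (i := \<alpha>) \<in> multiwords k n"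
      then have *: "(\<omega> (i := \<alpha>)) s \<in> words (n s)" if "s \<in> {1..k}" for s
        using that unfolding multiwords_def by (rule PiE_mem)
      have "\<omega> s \<in> words (n s)" if "s \<in> {1..k}" for s
        using *[OF that] assms(2) \<alpha> by (cases "s = i") auto
      moreover have "\<omega> s = undefined" if "s \<notin> {1..k}" for s
        using PiE_arb[OF \<open>\<omega> (i := \<alpha>) \<in> multiwords k n\<close>[unfolded multiwords_def] that]
          assms(1) that by (auto split: if_splits)
      ultimately show "\<omega> \<in> multiwords k n"
        unfolding multiwords_def by (rule PiE_I)
    next
      assume \<omega>: "\<omega> \<in> multiwords k n"
      then have "\<omega> i \<in> words (n i)"
        using assms(1) unfolding multiwords_def by (rule PiE_mem)
      then have "\<alpha> \<in> words (n i)"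
        using \<alpha> by simp
      then show "\<omega> (i := \<alpha>) \<in> multiwords k n"
        using \<omega> assms(1) unfolding multiwords_def PiE_iff by (auto simp: extensional_def)
    qed
    show ?thesis
      unfolding mshift_def ampliation_def fock_tensor_def split1 split2
      by (simp add: \<alpha> mem fock_wshift_def fock_shift_def fock_diag_def)
  qed
qed


section \<open>Weighted multi-Toeplitz operators\<close>

definition wcoef :: "nat \<Rightarrow> word \<Rightarrow> nat"
  where "wcoef M \<alpha> = (length \<alpha> + M - 1) choose (M - 1)"

text \<open>\<open>\<omega> \<ge>\<^sub>r \<gamma>\<close> is \<open>suffix \<gamma> \<omega>\<close>.\<close>

definition rquot :: "word \<Rightarrow> word \<Rightarrow> word"
  where "rquot \<omega> \<gamma> = (THE \<sigma>. \<omega> = \<sigma> @ \<gamma>)"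

definition rmax :: "word \<Rightarrow> word \<Rightarrow> word"
  where "rmax \<omega> \<gamma> = (if suffix \<gamma> \<omega> then \<omega> else \<gamma>)"

definition rmin :: "word \<Rightarrow> word \<Rightarrow> word"
  where "rmin \<omega> \<gamma> = (if suffix \<gamma> \<omega> then \<gamma> else \<omega>)"

definition comparable_pairs :: "nat \<Rightarrow> (nat \<Rightarrow> nat) \<Rightarrow> (multiword \<times> multiword) set"
  where "comparable_pairs k n =
    {(\<omega>, \<gamma>). \<omega> \<in> multiwords k n \<and> \<gamma> \<in> multiwords k n \<and>
      (\<forall>i\<in>{1..k}. suffix (\<gamma> i) (\<omega> i) \<or> suffix (\<omega> i) (\<gamma> i))}"

definition J_pairs :: "nat \<Rightarrow> (nat \<Rightarrow> nat) \<Rightarrow> (multiword \<times> multiword) set"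
  where "J_pairs k n =
    {(\<sigma>, \<beta>). (\<sigma>, \<beta>) \<in> comparable_pairs k n \<and>
      (\<exists>s::nat \<Rightarrow> int. \<forall>i\<in>{1..k}.
        int (length (\<sigma> i)) = max (s i) 0 \<and> int (length (\<beta> i)) = max (- s i) 0)}"

definition s_map :: "nat \<Rightarrow> multiword \<times> multiword \<Rightarrow> multiword \<times> multiword"
  where "s_map k = (\<lambda>(\<omega>, \<gamma>).
    (\<lambda>i\<in>{1..k}. if suffix (\<gamma> i) (\<omega> i) then rquot (\<omega> i) (\<gamma> i) else [],
     \<lambda>i\<in>{1..k}. if suffix (\<omega> i) (\<gamma> i) then rquot (\<gamma> i) (\<omega> i) else []))"

definition tau :: "nat \<Rightarrow> (nat \<Rightarrow> nat) \<Rightarrow> multiword \<times> multiword \<Rightarrow> real"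
  where "tau k m = (\<lambda>(\<omega>, \<gamma>).
    \<Prod>i = 1..k. sqrt (real (wcoef (m i) (rmin (\<omega> i) (\<gamma> i))) /
                      real (wcoef (m i) (rmax (\<omega> i) (\<gamma> i)))))"

definition multi_toeplitz ::
    "nat \<Rightarrow> (nat \<Rightarrow> nat) \<Rightarrow> (nat \<Rightarrow> nat) \<Rightarrow>
      ((multiword \<Rightarrow> 'a::complex_inner) \<Rightarrow> (multiword \<Rightarrow> 'a)) \<Rightarrow> bool"
  where "multi_toeplitz k m n T \<longleftrightarrow>
    (\<exists>B. (\<forall>p\<in>J_pairs k n. bounded_clinear (B p)) \<and>
      (\<forall>\<omega>\<in>multiwords k n. \<forall>\<gamma>\<in>multiwords k n. \<forall>x y.
        ell2_inner (T (ktensor x (multi_basis k n \<gamma>))) (ktensor y (multi_basis k n \<omega>)) =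
          (if (\<omega>, \<gamma>) \<in> comparable_pairs k n
           then complex_of_real (tau k m (\<omega>, \<gamma>)) * cinner (B (s_map k (\<omega>, \<gamma>)) x) y
           else 0)))"


section \<open>Formal Fourier representations\<close>

definition poly_vectors :: "nat \<Rightarrow> (nat \<Rightarrow> nat) \<Rightarrow> (multiword \<Rightarrow> 'a::complex_inner) set"
  where "poly_vectors k n = lspan {ktensor h (multi_basis k n \<alpha>) | h \<alpha>. \<alpha> \<in> multiwords k n}"

definition fourier_term ::
    "nat \<Rightarrow> (nat \<Rightarrow> nat) \<Rightarrow> (nat \<Rightarrow> nat) \<Rightarrow> (multiword \<times> multiword \<Rightarrow> 'a::complex_inner \<Rightarrow> 'a) \<Rightarrow>
      (multiword \<Rightarrow> 'a) \<Rightarrow> multiword \<times> multiword \<Rightarrow> (multiword \<Rightarrow> 'a)"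
  where "fourier_term k m n A p = (\<lambda>(\<alpha>, \<beta>).
    op_tensor (multiwords k n) (A (\<alpha>, \<beta>))
      (mshift_multi k m \<alpha> \<circ> ell2_adjoint (multiwords k n) (mshift_multi k m \<beta>)) p)"

text \<open>\<open>T p = \<phi>(W, W\<^sup>*) p\<close> for all \<open>p\<close> in \<open>poly_vectors\<close>, the series converging in norm.\<close>

definition fourier_represents ::
    "nat \<Rightarrow> (nat \<Rightarrow> nat) \<Rightarrow> (nat \<Rightarrow> nat) \<Rightarrow> (multiword \<times> multiword \<Rightarrow> 'a::complex_inner \<Rightarrow> 'a) \<Rightarrow>
      ((multiword \<Rightarrow> 'a) \<Rightarrow> (multiword \<Rightarrow> 'a)) \<Rightarrow> bool"
  where "fourier_represents k m n A T \<longleftrightarrow>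
    (\<forall>p\<in>poly_vectors k n. ell2_has_sum (fourier_term k m n A p) (T p) (J_pairs k n))"

end

theory Submission
  imports Defs
begin

text \<open>For fixed \<open>\<gamma>\<close>, the operator \<open>W\<^sub>\<alpha> W\<^sub>\<beta>\<^sup>*\<close> with \<open>(\<alpha>, \<beta>)\<close> in \<open>J_pairs\<close> sends \<open>e\<^sub>\<gamma>\<close> to
  \<open>tau (\<omega>, \<gamma>) e\<^sub>\<omega>\<close>, where \<open>\<omega>\<close> is the only word with \<open>s_map (\<omega>, \<gamma>) = (\<alpha>, \<beta>)\<close>, and to \<open>0\<close> if there
  is none. Hence the terms of the Fourier series with coefficients \<open>B\<close> at \<open>x \<otimes> e\<^sub>\<gamma>\<close> are exactly the
  coordinates of \<open>T (x \<otimes> e\<^sub>\<gamma>)\<close>, each occurring once, so the series converges to that vector.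
  Conversely, the coordinate of \<open>T (x \<otimes> e\<^sub>\<beta>)\<close> at \<open>\<sigma>\<close> is \<open>tau (\<sigma>, \<beta>) A\<^bsub>(\<sigma>, \<beta>)\<^esub> x\<close>, and \<open>tau\<close> never
  vanishes, so the coefficients are determined by \<open>T\<close>.\<close>

section \<open>Inner products and scalar multiplication\<close>

lemma cinner_zero_left [simp]: "cinner 0 (y::'a::complex_inner) = 0"
  using cinner_add_left[of 0 0 y] by simp

lemma cinner_zero_right [simp]: "cinner (x::'a::complex_inner) 0 = 0"
  by (metis cinner_commute cinner_zero_left complex_cnj_zero)

text \<open>Testing against \<open>y = z - w\<close> makes the squared norm of \<open>z - w\<close>
  vanish. This turns the weak description of matrix entries of an operator into equalities of
  vectors.\<close>

lemma cinner_ext: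
  fixes z w :: "'a::complex_inner"
  assumes "\<And>y. cinner z y = cinner w y"
  shows "z = w"
proof -
  have "cinner (z - w) (z - w) + cinner w (z - w) = cinner z (z - w)"
    by (simp flip: cinner_add_left)
  then have "inner (z - w) (z - w) = 0"
    using assms by (simp add: inner_eq_Re_cinner)
  then show ?thesis
    by simp
qed

lemma scaleC_left_cancel:
  assumes "c \<noteq> 0" "c *\<^sub>C x = c *\<^sub>C y"
  shows "x = y"
proof -
  have "inverse c *\<^sub>C c *\<^sub>C x = inverse c *\<^sub>C c *\<^sub>C y"
    using assms(2) by simp
  then show ?thesis
    unfolding scaleC_scaleC using assms(1) by simp
qed

lemma bounded_clinear_zero: "bounded_clinear B \<Longrightarrow> B 0 = 0"
  unfolding bounded_clinear_def using linear_0 bounded_linear.linear by blast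


section \<open>Square-summable families\<close>

lemma infsum_singleton_support:
  fixes f :: "'i \<Rightarrow> 'b::{comm_monoid_add,t2_space}"
  assumes "\<And>j. j \<noteq> i \<Longrightarrow> f j = 0"
  shows "infsum f UNIV = f i"
proof -
  have "(f has_sum f i) UNIV"
    by (rule has_sum_finite_neutralI[of "{i}"]) (use assms in auto)
  then show ?thesis
    by (rule infsumI)
qed

lemma ell2_finite_support:
  assumes "finite {i. f i \<noteq> 0}" "{i. f i \<noteq> 0} \<subseteq> I"
  shows "f \<in> ell2 I"
proof -
  have "finite {i\<in>I. (norm (f i))\<^sup>2 \<noteq> 0}"
    by (rule finite_subset[OF _ assms(1)]) auto
  then show ?thesis
    using assms(2) finite_nonzero_values_imp_summable_on[of I "\<lambda>i. (norm (f i))\<^sup>2"]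
    by (auto simp: ell2_def)
qed

lemma ell2_zero: "(\<lambda>_. 0) \<in> ell2 I"
  by (rule ell2_finite_support) auto

text \<open>Links two conventions: \<open>ell2\<close> asks for summability over \<open>I\<close>,
  while \<open>ell2_norm\<close> and \<open>ell2_inner\<close> sum over the whole index
  type.\<close>

lemma ell2_summable_UNIV:
  assumes "f \<in> ell2 I"
  shows "(\<lambda>i. (norm (f i))\<^sup>2) summable_on UNIV"
proof -
  have "(\<lambda>i. (norm (f i))\<^sup>2) summable_on I" "\<And>i. i \<notin> I \<Longrightarrow> f i = 0"
    using assms by (auto simp: ell2_def)
  then show ?thesis
    by (subst summable_on_cong_neutral[where T = I and g = "\<lambda>i. (norm (f i))\<^sup>2"]) auto
qed

lemma ell2_norm_nonneg: "ell2_norm f \<ge> 0"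
  by (simp add: ell2_norm_def infsum_nonneg)

lemma L2_set_le_ell2_norm:
  assumes "f \<in> ell2 I" "finite F"
  shows "L2_set (\<lambda>i. norm (f i)) F \<le> ell2_norm f"
  unfolding L2_set_def ell2_norm_def real_sqrt_le_iff
  by (rule finite_sum_le_infsum) (use assms ell2_summable_UNIV in auto)

lemma norm_le_ell2_norm:
  assumes "f \<in> ell2 I"
  shows "norm (f i) \<le> ell2_norm f"
  using L2_set_le_ell2_norm[OF assms, of "{i}"] by simp

text \<open>Minkowski's inequality for \<open>L2_set\<close> bounds all finite partial sums by the
  same \<open>N\<^sup>2\<close>. This one bound yields both summability and the norm
  estimate.\<close>

lemma
  assumes "f \<in> ell2 I" "g \<in> ell2 I"
  shows ell2_add: "(\<lambda>i. f i + g i) \<in> ell2 I"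
    and ell2_norm_triangle: "ell2_norm (\<lambda>i. f i + g i) \<le> ell2_norm f + ell2_norm g"
proof -
  define N where "N = ell2_norm f + ell2_norm g"
  have N: "N \<ge> 0"
    by (simp add: N_def ell2_norm_nonneg)
  have bound: "(\<Sum>i\<in>F. (norm (f i + g i))\<^sup>2) \<le> N\<^sup>2" if "finite F" for F
  proof -
    have "L2_set (\<lambda>i. norm (f i + g i)) F \<le> L2_set (\<lambda>i. norm (f i) + norm (g i)) F"
      by (intro L2_set_mono norm_triangle_ineq) auto
    also have "\<dots> \<le> L2_set (\<lambda>i. norm (f i)) F + L2_set (\<lambda>i. norm (g i)) F"
      by (rule L2_set_triangle_ineq)
    also have "\<dots> \<le> N"
      unfolding N_def
      by (intro add_mono L2_set_le_ell2_norm[OF assms(1)] L2_set_le_ell2_norm[OF assms(2)] that)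
    finally show ?thesis
      unfolding L2_set_def by (rule sqrt_le_D)
  qed
  have "bdd_above (sum (\<lambda>i. (norm (f i + g i))\<^sup>2) ` {F. F \<subseteq> A \<and> finite F})" for A
    using bound by (auto intro!: bdd_aboveI[of _ "N\<^sup>2"])
  then have summable: "(\<lambda>i. (norm (f i + g i))\<^sup>2) summable_on A" for A
    by (intro nonneg_bdd_above_summable_on) auto
  then show "(\<lambda>i. f i + g i) \<in> ell2 I"
    using assms by (simp add: ell2_def)
  have "(\<Sum>\<^sub>\<infinity>i. (norm (f i + g i))\<^sup>2) \<le> N\<^sup>2"
    by (intro infsum_le_finite_sums summable bound)
  then show "ell2_norm (\<lambda>i. f i + g i) \<le> ell2_norm f + ell2_norm g"
    unfolding ell2_norm_def[of "\<lambda>i. f i + g i"] N_def[symmetric]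
    by (intro real_le_lsqrt N)
qed

lemma ell2_uminus: "f \<in> ell2 I \<Longrightarrow> (\<lambda>i. - f i) \<in> ell2 I"
  by (simp add: ell2_def)

lemma ell2_diff: "f \<in> ell2 I \<Longrightarrow> g \<in> ell2 I \<Longrightarrow> (\<lambda>i. f i - g i) \<in> ell2 I"
  using ell2_add[OF _ ell2_uminus, of f I g] by simp

lemma ell2_sum:
  assumes "\<And>a. a \<in> S \<Longrightarrow> f a \<in> ell2 I"
  shows "(\<lambda>i. \<Sum>a\<in>S. f a i) \<in> ell2 I"
  using assms
  by (induction S rule: infinite_finite_induct) (simp_all add: ell2_zero ell2_add)

lemma ell2_norm_sum_le:
  assumes "\<And>a. a \<in> S \<Longrightarrow> f a \<in> ell2 I"
  shows "ell2_norm (\<lambda>i. \<Sum>a\<in>S. f a i) \<le> (\<Sum>a\<in>S. ell2_norm (f a))"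
  using assms
proof (induction S rule: infinite_finite_induct)
  case (insert a S)
  have "ell2_norm (\<lambda>i. f a i + (\<Sum>b\<in>S. f b i)) \<le> ell2_norm (f a) + ell2_norm (\<lambda>i. \<Sum>b\<in>S. f b i)"
    by (intro ell2_norm_triangle[of _ I] ell2_sum) (use insert.prems in auto)
  then show ?case
    using insert by fastforce
qed (simp_all add: ell2_norm_def)

section \<open>Convergence of series in \<open>ell2\<close>\<close>

lemma ell2_has_sum_cong:
  assumes "\<And>j. j \<in> J \<Longrightarrow> u j = u' j"
  shows "ell2_has_sum u s J \<longleftrightarrow> ell2_has_sum u' s J"
proof -
  have "(\<Sum>j\<in>F. u j i) = (\<Sum>j\<in>F. u' j i)" if "F \<subseteq> J" for F i
    by (rule sum.cong) (use that assms in auto)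
  then show ?thesis
    unfolding ell2_has_sum_def
    by (intro tendsto_cong eventually_finite_subsets_at_top_weakI) simp
qed

text \<open>The error of the combined series is the finite sum of the individual errors, so its norm
  is squeezed by the triangle inequality.\<close>

lemma ell2_has_sum_sum:
  assumes has_sum: "\<And>a. a \<in> S \<Longrightarrow> ell2_has_sum (u a) (s a) J"
    and u: "\<And>a j. a \<in> S \<Longrightarrow> j \<in> J \<Longrightarrow> u a j \<in> ell2 I"
    and s: "\<And>a. a \<in> S \<Longrightarrow> s a \<in> ell2 I"
  shows "ell2_has_sum (\<lambda>j i. \<Sum>a\<in>S. u a j i) (\<lambda>i. \<Sum>a\<in>S. s a i) J"
proof -
  define d where "d F a = (\<lambda>i. (\<Sum>j\<in>F. u a j i) - s a i)" for F a
  have eq: "(\<lambda>i. (\<Sum>j\<in>F. \<Sum>a\<in>S. u a j i) - (\<Sum>a\<in>S. s a i)) = (\<lambda>i. \<Sum>a\<in>S. d F a i)" for F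
    unfolding d_def by (subst sum.swap) (simp add: sum_subtractf)
  have "((\<lambda>F. \<Sum>a\<in>S. ell2_norm (d F a)) \<longlongrightarrow> (\<Sum>a\<in>S. 0)) (finite_subsets_at_top J)"
    using has_sum unfolding ell2_has_sum_def d_def by (intro tendsto_sum)
  then have lim: "((\<lambda>F. \<Sum>a\<in>S. ell2_norm (d F a)) \<longlongrightarrow> 0) (finite_subsets_at_top J)"
    by simp
  have "ell2_norm (\<lambda>i. \<Sum>a\<in>S. d F a i) \<le> (\<Sum>a\<in>S. ell2_norm (d F a))" if "F \<subseteq> J" for F
    by (rule ell2_norm_sum_le[of _ _ I])
      (use that u s in \<open>auto simp: d_def intro!: ell2_diff ell2_sum\<close>)
  then have "\<forall>\<^sub>F F in finite_subsets_at_top J.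
      norm (ell2_norm (\<lambda>i. \<Sum>a\<in>S. d F a i)) \<le> (\<Sum>a\<in>S. ell2_norm (d F a))"
    by (intro eventually_finite_subsets_at_top_weakI) (simp add: ell2_norm_nonneg)
  then show ?thesis
    unfolding ell2_has_sum_def eq by (rule Lim_null_comparison[OF _ lim])
qed

text \<open>Once a partial sum contains the term \<open>j\<close>, its coordinate at
  \<open>i\<close> stays equal to \<open>u j i\<close>. The constant
  \<open>norm (u j i - s i)\<close> is thus bounded by errors tending to 0. Uniqueness of the
  Fourier coefficients rests on this.\<close>

lemma ell2_has_sum_coordinate:
  assumes has_sum: "ell2_has_sum u s J"
    and u: "\<And>j. j \<in> J \<Longrightarrow> u j \<in> ell2 I" and s: "s \<in> ell2 I"
    and j: "j \<in> J" and other: "\<And>j'. j' \<in> J \<Longrightarrow> j' \<noteq> j \<Longrightarrow> u j' i = 0"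
  shows "u j i = s i"
proof -
  have "\<forall>\<^sub>F F in finite_subsets_at_top J.
      norm (u j i - s i) \<le> ell2_norm (\<lambda>i. (\<Sum>j\<in>F. u j i) - s i)"
    unfolding eventually_finite_subsets_at_top
  proof (intro exI[of _ "{j}"] conjI allI impI)
    fix F assume F: "finite F \<and> {j} \<subseteq> F \<and> F \<subseteq> J"
    then have "(\<Sum>j\<in>F. u j i) = u j i + (\<Sum>j\<in>F - {j}. u j i)"
      by (intro sum.remove) auto
    also have "(\<Sum>j\<in>F - {j}. u j i) = 0"
      using F other by (intro sum.neutral) auto
    finally show "norm (u j i - s i) \<le> ell2_norm (\<lambda>i. (\<Sum>j\<in>F. u j i) - s i)"
      using norm_le_ell2_norm[of "\<lambda>i. (\<Sum>j\<in>F. u j i) - s i" I i] F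
        ell2_diff[OF ell2_sum[of F u, OF u] s] by (simp add: subset_iff)
  qed (use j in auto)
  with has_sum[unfolded ell2_has_sum_def] have "norm (u j i - s i) \<le> 0"
    by (rule tendsto_lowerbound) simp
  then show ?thesis
    by simp
qed

lemma ell2_has_sum_coordinates:
  assumes f: "f \<in> ell2 I" and inj: "inj_on h C" and hC: "h ` C \<subseteq> J"
    and off: "\<And>i. i \<notin> C \<Longrightarrow> f i = 0"
    and u: "\<And>j i. j \<in> J \<Longrightarrow> u j i = (if i \<in> C \<and> h i = j then f i else 0)"
  shows "ell2_has_sum u f J"
proof -
  define N where "N i = (norm (f i))\<^sup>2" for i
  define s where "s = infsum N UNIV"
  \<comment> \<open>\<open>w\<close> carries the squared norms of the coordinates over to the label
    set \<open>J\<close>; \<open>G F\<close> collects the coordinates that a partial sum over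
    \<open>F\<close> recovers.\<close>
  define w where "w j = (if j \<in> h ` C then N (inv_into C h j) else 0)" for j
  define G where "G F = {i \<in> C. h i \<in> F}" for F
  have N: "(N has_sum s) UNIV"
    using ell2_summable_UNIV[OF f] unfolding N_def s_def by simp
  also have "?this \<longleftrightarrow> ((w \<circ> h) has_sum s) C"
    by (rule has_sum_cong_neutral) (auto simp: w_def inv_into_f_f[OF inj] N_def off)
  also have "\<dots> \<longleftrightarrow> (w has_sum s) (h ` C)"
    by (rule has_sum_reindex[OF inj, symmetric])
  also have "\<dots> \<longleftrightarrow> (w has_sum s) J"
    by (rule has_sum_cong_neutral) (use hC in \<open>auto simp: w_def\<close>)
  finally have w: "(sum w \<longlongrightarrow> s) (finite_subsets_at_top J)"
    by (simp add: has_sum_def)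
  \<comment> \<open>Pythagoras: a partial sum over \<open>F\<close> agrees with \<open>f\<close> on
    \<open>G F\<close> and is 0 elsewhere, so the squared error is the total \<open>s\<close> minus
    the part already recovered.\<close>
  have norm_eq: "ell2_norm (\<lambda>i. (\<Sum>j\<in>F. u j i) - f i) = sqrt (s - sum w F)"
    if F: "finite F" "F \<subseteq> J" for F
  proof -
    have finG: "finite (G F)"
      by (rule finite_imageD[of h]) (use F inj in \<open>auto simp: G_def intro: finite_subset[of _ F] inj_on_subset\<close>)
    have "sum w F = sum w (h ` G F)"
      by (rule sum.mono_neutral_right) (use F in \<open>auto simp: G_def w_def\<close>)
    also have "\<dots> = sum (w \<circ> h) (G F)"
      by (rule sum.reindex) (auto simp: G_def intro: inj_on_subset[OF inj])
    also have "\<dots> = sum N (G F)"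
      by (rule sum.cong) (auto simp: G_def w_def inv_into_f_f[OF inj])
    finally have sum_w: "sum w F = sum N (G F)" .
    have diff_eq: "(norm ((\<Sum>j\<in>F. u j i) - f i))\<^sup>2 = N i - (if i \<in> G F then N i else 0)" for i
    proof -
      have "(\<Sum>j\<in>F. u j i) = (\<Sum>j\<in>F. if h i = j then if i \<in> C then f i else 0 else 0)"
        by (rule sum.cong) (use F u in auto)
      also have "\<dots> = (if i \<in> G F then f i else 0)"
        using F by (auto simp: G_def)
      finally show ?thesis
        by (simp add: N_def)
    qed
    have "((\<lambda>i. if i \<in> G F then N i else 0) has_sum sum N (G F)) UNIV"
      by (rule has_sum_finite_neutralI[of "G F"]) (use finG in auto)
    then have "((\<lambda>i. N i - (if i \<in> G F then N i else 0)) has_sum (s - sum N (G F))) UNIV"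
      unfolding diff_conv_add_uminus by (intro has_sum_add[OF N]) (simp add: has_sum_uminus)
    then show ?thesis
      unfolding ell2_norm_def diff_eq sum_w by (simp add: infsumI)
  qed
  have "((\<lambda>F. sqrt (s - sum w F)) \<longlongrightarrow> sqrt (s - s)) (finite_subsets_at_top J)"
    by (intro tendsto_intros w)
  then have "((\<lambda>F. sqrt (s - sum w F)) \<longlongrightarrow> 0) (finite_subsets_at_top J)"
    by simp
  then show ?thesis
    unfolding ell2_has_sum_def
    by (rule Lim_transform_eventually)
      (auto intro!: eventually_finite_subsets_at_top_weakI simp: norm_eq)
qed

section \<open>Operators, elementary tensors and adjoints\<close>

lemma bounded_op_on_sum:
  fixes T :: "('i \<Rightarrow> 'a::complex_inner) \<Rightarrow> ('i \<Rightarrow> 'a)"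
  assumes T: "bounded_op_on I T" and f: "\<And>a. a \<in> S \<Longrightarrow> f a \<in> ell2 I"
  shows "T (\<lambda>i. \<Sum>a\<in>S. f a i) = (\<lambda>i. \<Sum>a\<in>S. T (f a) i)"
proof -
  have "T (\<lambda>i. c *\<^sub>C f i) = (\<lambda>i. c *\<^sub>C T f i)" if "f \<in> ell2 I" for c f
    using T that by (simp add: bounded_op_on_def)
  \<comment> \<open>Homogeneity with scalar 0 settles the empty sum, and also the case of infinite
    \<open>S\<close>, where the sum is 0 by convention.\<close>
  from this[OF ell2_zero, of 0] have T0: "T (\<lambda>i. 0) = (\<lambda>i. 0)"
    by simp
  show ?thesis
    using f
  proof (induction S rule: infinite_finite_induct)
    case (insert a S)
    have "T (\<lambda>i. f a i + (\<Sum>b\<in>S. f b i)) = (\<lambda>i. T (f a) i + T (\<lambda>i. \<Sum>b\<in>S. f b i) i)"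
      using T insert.prems ell2_sum[of S f I] unfolding bounded_op_on_def by simp
    then show ?case
      using insert by simp
  qed (simp_all add: T0)
qed

lemma ktensor_ket_apply: "ktensor x (ket i) j = (if j = i then x else 0)"
  by (simp add: ktensor_def ket_def)

lemma ktensor_ket_in_ell2: "i \<in> I \<Longrightarrow> ktensor x (ket i) \<in> ell2 I"
  by (rule ell2_finite_support) (auto simp: ktensor_ket_apply intro: finite_subset[of _ "{i}"])

lemma ell2_inner_ktensor_ket: "ell2_inner f (ktensor y (ket i)) = cinner (f i) y"
  unfolding ell2_inner_def
  by (subst infsum_singleton_support[of i]) (auto simp: ktensor_ket_apply)

lemma ell2_inner_ket: "ell2_inner f (ket i) = f i"
  unfolding ell2_inner_def
  by (subst infsum_singleton_support[of i]) (auto simp: ket_def cinner_complex_def)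

text \<open>If the coordinate at \<gamma> of \<open>X f\<close> only sees the coordinate of
  \<open>f\<close> at \<gamma>', then pairing with \<open>ket \<gamma>\<close> is pairing with a
  multiple of \<open>ket \<gamma>'\<close>. This candidate satisfies the identity in the definite
  description. Any other solution agrees with it on \<open>I\<close> by testing against
  \<open>ket i\<close>, and off \<open>I\<close> both vanish.\<close>

lemma ell2_adjoint_ket:
  assumes g: "\<gamma>' \<in> I" and X: "\<And>f. f \<in> ell2 I \<Longrightarrow> X f \<gamma> = c * f \<gamma>'"
  shows "ell2_adjoint I X (ket \<gamma>) = (\<lambda>i. cnj c * ket \<gamma>' i)"
  unfolding ell2_adjoint_def
proof (rule the_equality)
  let ?h = "\<lambda>i. cnj c * ket \<gamma>' i"
  have h: "?h \<in> ell2 I"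
    by (rule ell2_finite_support) (use g in \<open>auto simp: ket_def split: if_splits\<close>)
  have inner: "ell2_inner (X f) (ket \<gamma>) = ell2_inner f ?h" if "f \<in> ell2 I" for f
  proof -
    have "ell2_inner f ?h = f \<gamma>' * c"
      unfolding ell2_inner_def
      by (subst infsum_singleton_support[of \<gamma>']) (auto simp: ket_def cinner_complex_def)
    then show ?thesis
      using X[OF that] by (simp add: ell2_inner_ket)
  qed
  show "?h \<in> ell2 I \<and> (\<forall>f\<in>ell2 I. ell2_inner (X f) (ket \<gamma>) = ell2_inner f ?h)"
    using h inner by blast
  fix h assume *: "h \<in> ell2 I \<and> (\<forall>f\<in>ell2 I. ell2_inner (X f) (ket \<gamma>) = ell2_inner f h)"
  have coord: "ell2_inner (ket i) g = cnj (g i)" for g :: "'a \<Rightarrow> complex" and i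
    unfolding ell2_inner_def
    by (subst infsum_singleton_support[of i]) (auto simp: ket_def cinner_complex_def)
  show "h = ?h"
  proof
    fix i
    show "h i = ?h i"
    proof (cases "i \<in> I")
      case True
      have ket: "ket i \<in> ell2 I"
        by (rule ell2_finite_support) (use True in \<open>auto simp: ket_def split: if_splits\<close>)
      have "ell2_inner (ket i) h = ell2_inner (ket i) ?h"
        using * inner[OF ket] ket by metis
      then show ?thesis
        unfolding coord complex_cnj_cancel_iff .
    next
      case False
      then show ?thesis
        using * h by (auto simp: ell2_def)
    qed
  qed
qed

text \<open>Each generator of the span is supported at a single multiword, and a linear combination
  involves finitely many generators.\<close>

lemma poly_vectors_finite_support:
  assumes "p \<in> poly_vectors k n"
  shows "finite {i. p i \<noteq> 0}" "{i. p i \<noteq> 0} \<subseteq> multiwords k n"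
proof -
  obtain t c where p: "p = (\<lambda>i. \<Sum>v\<in>t. c v *\<^sub>C v i)" and t: "finite t"
    and sub: "t \<subseteq> {ktensor h (multi_basis k n \<alpha>) | h \<alpha>. \<alpha> \<in> multiwords k n}"
    using assms unfolding poly_vectors_def lspan_def by blast
  have "\<exists>\<alpha>\<in>multiwords k n. \<forall>i. i \<noteq> \<alpha> \<longrightarrow> v i = 0" if "v \<in> t" for v
    using that sub by (fastforce simp: multi_basis_eq_ket ktensor_ket_apply)
  then obtain a where a: "\<And>v. v \<in> t \<Longrightarrow> a v \<in> multiwords k n"
    and v: "\<And>v i. v \<in> t \<Longrightarrow> i \<noteq> a v \<Longrightarrow> v i = 0"
    by metis
  have "{i. p i \<noteq> 0} \<subseteq> a ` t"
  proof
    fix i assume "i \<in> {i. p i \<noteq> 0}"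
    then obtain w where "w \<in> t" "c w *\<^sub>C w i \<noteq> 0"
      unfolding p using sum.not_neutral_contains_not_neutral by blast
    then show "i \<in> a ` t"
      using v by force
  qed
  then show "finite {i. p i \<noteq> 0}" "{i. p i \<noteq> 0} \<subseteq> multiwords k n"
    using t a by (auto intro: finite_subset)
qed

lemma ktensor_ket_in_poly_vectors:
  assumes "\<gamma> \<in> multiwords k n"
  shows "ktensor x (ket \<gamma>) \<in> poly_vectors k n"
proof -
  let ?v = "ktensor x (multi_basis k n \<gamma>)"
  have "?v = (\<lambda>i. \<Sum>v\<in>{?v}. 1 *\<^sub>C v i)" "finite {?v}"
    "{?v} \<subseteq> {ktensor h (multi_basis k n \<alpha>) | h \<alpha>. \<alpha> \<in> multiwords k n}"
    using assms by auto
  then have "?v \<in> poly_vectors k n"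
    unfolding poly_vectors_def lspan_def mem_Collect_eq by (intro exI conjI)
  then show ?thesis
    by (simp add: multi_basis_eq_ket[OF assms])
qed


section \<open>Weighted shifts\<close>

lemma wcoef_pos: "M \<ge> 1 \<Longrightarrow> wcoef M \<alpha> > 0"
  by (simp add: wcoef_def)

text \<open>The right-hand side is the square of the weight in \<open>fock_diag\<close>. Writing it
  as a ratio of binomial weights is what makes products of shifts telescope.\<close>

lemma wcoef_Cons_ratio:
  assumes "M \<ge> 1"
  shows "real (wcoef M \<alpha>) / real (wcoef M (j # \<alpha>)) =
    (real (length \<alpha>) + 1) / (real (length \<alpha>) + real M)"
proof -
  obtain M' where M: "M = Suc M'"
    using assms by (cases M) auto
  \<comment> \<open>This is \<open>(N - K) * (N choose K) = N * ((N - 1) choose K)\<close> with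
    \<open>N = length \<alpha> + M\<close> and \<open>K = M - 1\<close>.\<close>
  have "Suc (length \<alpha>) * wcoef M (j # \<alpha>) = (length \<alpha> + M) * wcoef M \<alpha>"
    using binomial_absorb_comp[of "Suc (length \<alpha>) + M'" M'] by (simp add: M wcoef_def)
  then have "(real (length \<alpha>) + 1) * real (wcoef M (j # \<alpha>)) =
      (real (length \<alpha>) + real M) * real (wcoef M \<alpha>)"
    by (metis Suc_eq_plus1 of_nat_1 of_nat_add of_nat_mult)
  moreover have "real (wcoef M (j # \<alpha>)) > 0" "real (length \<alpha>) + real M > 0"
    using wcoef_pos[OF assms] assms by auto
  ultimately show ?thesis
    by (simp add: field_simps)
qed

text \<open>The weight collected when shifts lead from the basis vector of \<gamma> to that of a
  longer word \<omega>. The factors of \<open>tau\<close> have the same form, from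
  \<open>rmin\<close> to \<open>rmax\<close>.\<close>

definition wratio :: "nat \<Rightarrow> word \<Rightarrow> word \<Rightarrow> real"
  where "wratio M \<gamma> \<omega> = sqrt (real (wcoef M \<gamma>) / real (wcoef M \<omega>))"

lemma wratio_mult: "M \<ge> 1 \<Longrightarrow> wratio M \<alpha> \<beta> * wratio M \<beta> \<gamma> = wratio M \<alpha> \<gamma>"
  using wcoef_pos[of M \<beta>] by (simp add: wratio_def flip: real_sqrt_mult)

lemma wratio_self: "M \<ge> 1 \<Longrightarrow> wratio M \<alpha> \<alpha> = 1"
  using wcoef_pos[of M \<alpha>] by (simp add: wratio_def)

text \<open>Induction on \<alpha>: the outermost shift strips the first letter of
  \<open>\<omega> i\<close>, and the weights telescope through \<open>wratio_mult\<close>. Stating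
  this by coordinates for arbitrary \<open>f\<close> lets the adjoint be read off from the same
  formula.\<close>

lemma mshift_word_apply:
  assumes "m i \<ge> 1"
  shows "mshift_word m i \<alpha> f \<omega> =
    (if prefix \<alpha> (\<omega> i)
     then complex_of_real (wratio (m i) (drop (length \<alpha>) (\<omega> i)) (\<omega> i)) *
       f (\<omega> (i := drop (length \<alpha>) (\<omega> i)))
     else 0)"
proof (induction \<alpha> arbitrary: \<omega>)
  case Nil
  then show ?case
    by (simp add: mshift_word_def wratio_self[OF assms])
next
  case (Cons j \<alpha>)
  have step: "mshift_word m i (j # \<alpha>) f \<omega> = mshift m i j (mshift_word m i \<alpha> f) \<omega>"
    by (simp add: mshift_word_def)
  show ?case
  proof (cases "\<exists>v. \<omega> i = j # v")
    case True
    then obtain v where v: "\<omega> i = j # v"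
      by blast
    have "mshift m i j g \<omega> = complex_of_real (wratio (m i) v (j # v)) * g (\<omega> (i := v))" for g
      by (simp add: mshift_def ampliation_def fock_wshift_def fock_shift_def fock_diag_def v
          wratio_def wcoef_Cons_ratio[OF assms])
    then have "mshift_word m i (j # \<alpha>) f \<omega> =
        complex_of_real (wratio (m i) v (j # v)) * mshift_word m i \<alpha> f (\<omega> (i := v))"
      unfolding step .
    also have "\<dots> = (if prefix \<alpha> v
        then complex_of_real (wratio (m i) v (j # v)) * (complex_of_real
          (wratio (m i) (drop (length \<alpha>) v) v) * f (\<omega> (i := drop (length \<alpha>) v))) else 0)"
      by (simp add: Cons.IH)
    also have "complex_of_real (wratio (m i) v (j # v)) * (complex_of_real
          (wratio (m i) (drop (length \<alpha>) v) v) * z) =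
        complex_of_real (wratio (m i) (drop (length \<alpha>) v) (j # v)) * z" for z
      using wratio_mult[OF assms, of "drop (length \<alpha>) v" v "j # v"]
      by (metis mult.assoc mult.commute of_real_mult)
    finally show ?thesis
      by (simp add: v fun_upd_def)
  next
    case False
    then have "mshift m i j g \<omega> = 0" for g
      by (auto simp: mshift_def ampliation_def fock_wshift_def fock_shift_def split: list.splits)
    moreover have "\<not> prefix (j # \<alpha>) (\<omega> i)"
      using False by (auto simp: prefix_def)
    ultimately show ?thesis
      unfolding step by simp
  qed
qed

text \<open>The set \<open>S\<close> records the coordinates already treated in an induction over
  the tensor factors; the full operation has \<open>S = {1..k}\<close>.\<close>

definition mdrop :: "nat set \<Rightarrow> multiword \<Rightarrow> multiword \<Rightarrow> multiword"
  where "mdrop S \<alpha> \<omega> = (\<lambda>i. if i \<in> S then drop (length (\<alpha> i)) (\<omega> i) else \<omega> i)"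

text \<open>Generalized from the list \<open>[1..<Suc k]\<close> to allow induction. Distinctness
  ensures that the head changes a coordinate which the remaining factors do not touch.\<close>

lemma foldr_mshift_word_apply:
  assumes "distinct is" "\<forall>i\<in>set is. m i \<ge> 1"
  shows "foldr (\<lambda>i X. mshift_word m i (\<alpha> i) \<circ> X) is id f \<omega> =
    (if \<forall>i\<in>set is. prefix (\<alpha> i) (\<omega> i)
     then complex_of_real (\<Prod>i\<in>set is. wratio (m i) (drop (length (\<alpha> i)) (\<omega> i)) (\<omega> i)) *
       f (mdrop (set is) \<alpha> \<omega>)
     else 0)"
  using assms
proof (induction "is" arbitrary: \<omega>)
  case Nil
  then show ?case
    by (simp add: mdrop_def)
next
  case (Cons l ls)
  let ?v = "\<omega> (l := drop (length (\<alpha> l)) (\<omega> l))"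
  have v: "?v i = \<omega> i" if "i \<in> set ls" for i
    using that Cons.prems by auto
  have "mdrop (set ls) \<alpha> ?v = mdrop (set (l # ls)) \<alpha> \<omega>"
    using Cons.prems by (auto simp: mdrop_def fun_eq_iff)
  moreover have "(\<forall>i\<in>set ls. prefix (\<alpha> i) (?v i)) \<longleftrightarrow> (\<forall>i\<in>set ls. prefix (\<alpha> i) (\<omega> i))"
    using v by simp
  moreover have "(\<Prod>i\<in>set ls. wratio (m i) (drop (length (\<alpha> i)) (?v i)) (?v i)) =
      (\<Prod>i\<in>set ls. wratio (m i) (drop (length (\<alpha> i)) (\<omega> i)) (\<omega> i))"
    by (rule prod.cong[OF refl]) (simp only: v)
  moreover have "foldr (\<lambda>i X. mshift_word m i (\<alpha> i) \<circ> X) (l # ls) id f \<omega> =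
      mshift_word m l (\<alpha> l) (foldr (\<lambda>i X. mshift_word m i (\<alpha> i) \<circ> X) ls id f) \<omega>"
    by simp
  ultimately show ?case
    using Cons.prems Cons.IH[of ?v] by (simp add: mshift_word_apply del: fun_upd_apply)
qed

lemma mshift_multi_apply:
  assumes "\<forall>i\<in>{1..k}. m i \<ge> 1"
  shows "mshift_multi k m \<alpha> f \<omega> =
    (if \<forall>i\<in>{1..k}. prefix (\<alpha> i) (\<omega> i)
     then complex_of_real (\<Prod>i = 1..k. wratio (m i) (drop (length (\<alpha> i)) (\<omega> i)) (\<omega> i)) *
       f (mdrop {1..k} \<alpha> \<omega>)
     else 0)"
proof -
  have "set [1..<Suc k] = {1..k}"
    by auto
  then show ?thesis
    unfolding mshift_multi_def using assms foldr_mshift_word_apply[of "[1..<Suc k]" m \<alpha> f \<omega>]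
    by (simp del: upt_Suc)
qed

lemma multiwords_mem: "\<omega> \<in> multiwords k n \<longleftrightarrow>
    (\<forall>i\<in>{1..k}. \<omega> i \<in> words (n i)) \<and> (\<forall>i. i \<notin> {1..k} \<longrightarrow> \<omega> i = undefined)"
  by (auto simp: multiwords_def PiE_iff extensional_def)

lemma multiwords_eqI:
  assumes "\<omega> \<in> multiwords k n" "\<gamma> \<in> multiwords k n" "\<And>i. i \<in> {1..k} \<Longrightarrow> \<omega> i = \<gamma> i"
  shows "\<omega> = \<gamma>"
  using assms unfolding multiwords_def by (rule PiE_ext)

lemma words_drop: "u \<in> words N \<Longrightarrow> drop l u \<in> words N"
  by (auto dest: in_set_dropD)

lemma mdrop_multiwords: "\<omega> \<in> multiwords k n \<Longrightarrow> mdrop {1..k} \<alpha> \<omega> \<in> multiwords k n"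
  by (simp add: multiwords_mem mdrop_def words_drop del: One_nat_def)

lemma ell2_adjoint_mshift_multi_ket:
  assumes m: "\<forall>i\<in>{1..k}. m i \<ge> 1" and \<gamma>: "\<gamma> \<in> multiwords k n"
  shows "ell2_adjoint (multiwords k n) (mshift_multi k m \<beta>) (ket \<gamma>) =
    (\<lambda>\<omega>. if \<forall>i\<in>{1..k}. prefix (\<beta> i) (\<gamma> i)
      then complex_of_real (\<Prod>i = 1..k. wratio (m i) (drop (length (\<beta> i)) (\<gamma> i)) (\<gamma> i)) *
        ket (mdrop {1..k} \<beta> \<gamma>) \<omega>
      else 0)"
proof -
  \<comment> \<open>Taking the scalar 0 when some prefix condition fails puts both cases into the
    form required by \<open>ell2_adjoint_ket\<close>; \<open>mdrop {1..k} \<beta> \<gamma>\<close>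
    is a multiword in either case.\<close>
  let ?c = "if \<forall>i\<in>{1..k}. prefix (\<beta> i) (\<gamma> i)
      then complex_of_real (\<Prod>i = 1..k. wratio (m i) (drop (length (\<beta> i)) (\<gamma> i)) (\<gamma> i)) else 0"
  have "ell2_adjoint (multiwords k n) (mshift_multi k m \<beta>) (ket \<gamma>) =
      (\<lambda>i. cnj ?c * ket (mdrop {1..k} \<beta> \<gamma>) i)"
    by (rule ell2_adjoint_ket)
      (simp_all add: mshift_multi_apply[OF m] mdrop_multiwords[OF \<gamma>] del: One_nat_def)
  then show ?thesis
    by (auto simp: fun_eq_iff)
qed


section \<open>Comparable pairs\<close>

lemma rquot_append [simp]: "rquot (\<sigma> @ \<gamma>) \<gamma> = \<sigma>"
  by (simp add: rquot_def)

text \<open>The one-coordinate form of the correspondence: \<open>v = b @ g\<close> and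
  \<open>w = a @ g\<close> for a common \<open>g\<close>. As \<open>a\<close> or \<open>b\<close> is
  empty, \<open>g\<close> is the shorter of the two words, and \<open>a\<close>, \<open>b\<close>
  are recovered as right quotients.\<close>

lemma common_suffix_iff:
  assumes "a = [] \<or> b = []"
  shows "prefix b v \<and> prefix a w \<and> drop (length a) w = drop (length b) v \<longleftrightarrow>
    (suffix v w \<or> suffix w v) \<and>
    (if suffix v w then rquot w v else []) = a \<and> (if suffix w v then rquot v w else []) = b"
    (is "?L \<longleftrightarrow> ?R")
proof
  assume ?L
  then obtain g where g: "v = b @ g" "w = a @ g"
    by (auto simp: prefix_def)
  show ?R
    using assms
  proof
    assume "a = []"
    then show ?thesis
      using g rquot_append[of "[]" g] rquot_append[of b g]
      by (cases "b = []") (auto simp: suffix_def)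
  next
    assume "b = []"
    then show ?thesis
      using g rquot_append[of "[]" g] rquot_append[of a g]
      by (cases "a = []") (auto simp: suffix_def)
  qed
next
  assume R: ?R
  then have "suffix v w \<or> suffix w v"
    by blast
  then show ?L
  proof
    assume "suffix v w"
    then obtain c where c: "w = c @ v"
      by (auto simp: suffix_def)
    then have "a = c"
      using R by (simp add: suffix_def)
    \<comment> \<open>If \<open>c = []\<close>, the words coincide and the quotient is still empty;
      otherwise \<open>w\<close> is too long to be a suffix of \<open>v\<close>.\<close>
    moreover have "b = []"
      using R c rquot_append[of "[]" v] by (cases "c = []") (auto simp: suffix_def)
    ultimately show ?thesis
      using c by simp
  next
    assume "suffix w v"
    then obtain c where c: "v = c @ w"
      by (auto simp: suffix_def)
    then have "b = c"
      using R by (simp add: suffix_def)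
    moreover have "a = []"
      using R c rquot_append[of "[]" w] by (cases "c = []") (auto simp: suffix_def)
    ultimately show ?thesis
      using c by simp
  qed
qed

text \<open>One factor is \<open>wratio M g g = 1\<close>; the other leads from the shorter word
  \<open>g\<close> to the longer one, as in \<open>tau\<close>.\<close>

lemma wratio_rmin_rmax:
  assumes "a = [] \<or> b = []" "M \<ge> 1"
  shows "wratio M g (a @ g) * wratio M g (b @ g) =
    wratio M (rmin (a @ g) (b @ g)) (rmax (a @ g) (b @ g))"
  using assms(1)
proof
  assume "a = []"
  then show ?thesis
    by (cases "b = []") (auto simp: wratio_self[OF assms(2)] rmin_def rmax_def suffix_def)
next
  assume "b = []"
  then show ?thesis
    by (auto simp: wratio_self[OF assms(2)] rmin_def rmax_def suffix_def)
qed

text \<open>The positive and negative parts of an integer are never both nonzero. Conversely the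
  difference of the lengths serves as \<open>s i\<close>, and the empty word is a suffix of every
  word.\<close>

lemma J_pairs_mem: "(\<sigma>, \<beta>) \<in> J_pairs k n \<longleftrightarrow>
    \<sigma> \<in> multiwords k n \<and> \<beta> \<in> multiwords k n \<and> (\<forall>i\<in>{1..k}. \<sigma> i = [] \<or> \<beta> i = [])"
    (is "?L \<longleftrightarrow> ?R")
proof
  assume ?L
  then obtain s :: "nat \<Rightarrow> int" where
    "\<sigma> \<in> multiwords k n" "\<beta> \<in> multiwords k n" and
    s: "\<And>i. i \<in> {1..k} \<Longrightarrow> int (length (\<sigma> i)) = max (s i) 0 \<and> int (length (\<beta> i)) = max (- s i) 0"
    unfolding J_pairs_def comparable_pairs_def by blast
  moreover have "\<sigma> i = [] \<or> \<beta> i = []" if "i \<in> {1..k}" for i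
  proof -
    have "length (\<sigma> i) = 0 \<or> length (\<beta> i) = 0"
      using s[OF that] by linarith
    then show ?thesis
      by simp
  qed
  ultimately show ?R
    by blast
next
  assume R: ?R
  let ?s = "\<lambda>i. int (length (\<sigma> i)) - int (length (\<beta> i))"
  have "\<forall>i\<in>{1..k}. int (length (\<sigma> i)) = max (?s i) 0 \<and> int (length (\<beta> i)) = max (- ?s i) 0"
    "\<forall>i\<in>{1..k}. suffix (\<beta> i) (\<sigma> i) \<or> suffix (\<sigma> i) (\<beta> i)"
    using R by force+
  then show ?L
    unfolding J_pairs_def comparable_pairs_def using R by fast
qed

text \<open>The left-hand side says that \<open>\<gamma> = \<beta>\<delta>\<close> and \<open>\<omega> = \<alpha>\<delta>\<close> for a common \<open>\<delta>\<close>.\<close>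

lemma s_map_eq_iff:
  assumes J: "(\<alpha>, \<beta>) \<in> J_pairs k n" and \<omega>: "\<omega> \<in> multiwords k n" and \<gamma>: "\<gamma> \<in> multiwords k n"
  shows "(\<forall>i\<in>{1..k}. prefix (\<beta> i) (\<gamma> i)) \<and> (\<forall>i\<in>{1..k}. prefix (\<alpha> i) (\<omega> i)) \<and>
      mdrop {1..k} \<alpha> \<omega> = mdrop {1..k} \<beta> \<gamma> \<longleftrightarrow>
    (\<omega>, \<gamma>) \<in> comparable_pairs k n \<and> s_map k (\<omega>, \<gamma>) = (\<alpha>, \<beta>)" (is "?L \<longleftrightarrow> ?R")
proof -
  let ?P = "\<lambda>i. prefix (\<beta> i) (\<gamma> i) \<and> prefix (\<alpha> i) (\<omega> i) \<and>
    drop (length (\<alpha> i)) (\<omega> i) = drop (length (\<beta> i)) (\<gamma> i)"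
  let ?a = "\<lambda>i. if suffix (\<gamma> i) (\<omega> i) then rquot (\<omega> i) (\<gamma> i) else []"
  let ?b = "\<lambda>i. if suffix (\<omega> i) (\<gamma> i) then rquot (\<gamma> i) (\<omega> i) else []"
  \<comment> \<open>Multiwords and restricted functions are both \<open>undefined\<close> outside
    \<open>{1..k}\<close>, so equality may be checked coordinatewise.\<close>
  have restrict: "(\<lambda>i\<in>{1..k}. c i) = \<delta> \<longleftrightarrow> (\<forall>i\<in>{1..k}. c i = \<delta> i)"
    if "\<delta> \<in> multiwords k n" for c \<delta>
    using that unfolding multiwords_mem restrict_def fun_eq_iff by metis
  have "mdrop {1..k} \<alpha> \<omega> = mdrop {1..k} \<beta> \<gamma> \<longleftrightarrow>
      (\<forall>i\<in>{1..k}. drop (length (\<alpha> i)) (\<omega> i) = drop (length (\<beta> i)) (\<gamma> i))"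
    using \<omega> \<gamma> by (auto simp: multiwords_mem mdrop_def fun_eq_iff)
  then have "?L \<longleftrightarrow> (\<forall>i\<in>{1..k}. ?P i)"
    by blast
  also have "\<dots> \<longleftrightarrow> (\<forall>i\<in>{1..k}. (suffix (\<gamma> i) (\<omega> i) \<or> suffix (\<omega> i) (\<gamma> i)) \<and> ?a i = \<alpha> i \<and> ?b i = \<beta> i)"
    using J by (intro ball_cong refl common_suffix_iff) (auto simp: J_pairs_mem)
  also have "\<dots> \<longleftrightarrow> ?R"
    using J \<omega> \<gamma> by (auto simp: comparable_pairs_def s_map_def J_pairs_mem restrict
        simp del: One_nat_def)
  finally show ?thesis .
qed

lemma s_map_in_J_pairs:
  assumes "(\<omega>, \<gamma>) \<in> comparable_pairs k n"
  shows "s_map k (\<omega>, \<gamma>) \<in> J_pairs k n"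
proof -
  let ?a = "\<lambda>i. if suffix (\<gamma> i) (\<omega> i) then rquot (\<omega> i) (\<gamma> i) else []"
  let ?b = "\<lambda>i. if suffix (\<omega> i) (\<gamma> i) then rquot (\<gamma> i) (\<omega> i) else []"
  have rquot_words: "rquot u v \<in> words N" if "suffix v u" "u \<in> words N" for u v N
    using that by (auto simp: suffix_def)
  have \<omega>: "\<omega> \<in> multiwords k n" and \<gamma>: "\<gamma> \<in> multiwords k n"
    using assms by (auto simp: comparable_pairs_def)
  have "?a i \<in> words (n i)" "?b i \<in> words (n i)" if "i \<in> {1..k}" for i
    using that \<omega> \<gamma> rquot_words by (auto simp: multiwords_mem)
  \<comment> \<open>When both suffix tests succeed, the two words are equal and both quotients are
    empty.\<close>
  moreover have "?a i = [] \<or> ?b i = []" for i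
    using rquot_append[of "[]" "\<omega> i"] by (auto dest: suffix_order.antisym)
  ultimately show ?thesis
    by (simp add: s_map_def J_pairs_mem multiwords_mem)
qed

text \<open>The common remainder is the empty word in each coordinate. Hence the coefficient with
  index \<open>(\<sigma>, \<beta>)\<close> is visible in the matrix entry at the same pair.\<close>

lemma s_map_self:
  assumes "(\<sigma>, \<beta>) \<in> J_pairs k n"
  shows "(\<sigma>, \<beta>) \<in> comparable_pairs k n" "s_map k (\<sigma>, \<beta>) = (\<sigma>, \<beta>)"
proof -
  have "\<sigma> \<in> multiwords k n" "\<beta> \<in> multiwords k n"
    using assms by (auto simp: J_pairs_mem)
  then have "(\<sigma>, \<beta>) \<in> comparable_pairs k n \<and> s_map k (\<sigma>, \<beta>) = (\<sigma>, \<beta>)"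
    by (subst s_map_eq_iff[OF assms, symmetric]) (auto simp: mdrop_def multiwords_mem fun_eq_iff)
  then show "(\<sigma>, \<beta>) \<in> comparable_pairs k n" "s_map k (\<sigma>, \<beta>) = (\<sigma>, \<beta>)"
    by auto
qed

text \<open>The value \<open>(\<alpha>, \<beta>)\<close> together with \<gamma> determines the
  common remainder, namely \<gamma> with \<beta> stripped off; prepending \<alpha> recovers
  \<omega>.\<close>

lemma s_map_inj_on: "inj_on (\<lambda>\<omega>. s_map k (\<omega>, \<gamma>)) {\<omega>. (\<omega>, \<gamma>) \<in> comparable_pairs k n}"
proof (rule inj_onI)
  fix \<omega> \<omega>'
  assume C: "\<omega> \<in> {\<omega>. (\<omega>, \<gamma>) \<in> comparable_pairs k n}" "\<omega>' \<in> {\<omega>. (\<omega>, \<gamma>) \<in> comparable_pairs k n}"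
    and eq: "s_map k (\<omega>, \<gamma>) = s_map k (\<omega>', \<gamma>)"
  obtain \<alpha> \<beta> where ab: "s_map k (\<omega>, \<gamma>) = (\<alpha>, \<beta>)"
    by (cases "s_map k (\<omega>, \<gamma>)")
  have J: "(\<alpha>, \<beta>) \<in> J_pairs k n"
    using s_map_in_J_pairs[of \<omega> \<gamma> k n] C ab by simp
  have mem: "\<omega> \<in> multiwords k n" "\<omega>' \<in> multiwords k n" "\<gamma> \<in> multiwords k n"
    using C by (auto simp: comparable_pairs_def)
  have *: "\<forall>i\<in>{1..k}. prefix (\<alpha> i) (\<omega> i)" "\<forall>i\<in>{1..k}. prefix (\<alpha> i) (\<omega>' i)"
    "mdrop {1..k} \<alpha> \<omega> = mdrop {1..k} \<alpha> \<omega>'"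
    using s_map_eq_iff[OF J mem(1,3)] s_map_eq_iff[OF J mem(2,3)] C ab eq by auto
  show "\<omega> = \<omega>'"
  proof (rule multiwords_eqI[OF mem(1,2)])
    fix i assume i: "i \<in> {1..k}"
    then have "drop (length (\<alpha> i)) (\<omega> i) = drop (length (\<alpha> i)) (\<omega>' i)"
      using fun_cong[OF *(3), of i] by (simp add: mdrop_def)
    moreover have "prefix (\<alpha> i) (\<omega> i)" "prefix (\<alpha> i) (\<omega>' i)"
      using * i by blast+
    ultimately show "\<omega> i = \<omega>' i"
      by (auto simp: prefix_def)
  qed
qed


section \<open>Fourier representations\<close>

text \<open>The adjoint strips \<beta> from \<gamma> and the shift prepends \<alpha> to what
  remains; the two collected weights multiply to \<open>tau\<close>.\<close>

lemma mshift_multi_adjoint_ket: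
  assumes m: "\<forall>i\<in>{1..k}. m i \<ge> 1"
    and J: "(\<alpha>, \<beta>) \<in> J_pairs k n" and \<gamma>: "\<gamma> \<in> multiwords k n"
  shows "mshift_multi k m \<alpha> (ell2_adjoint (multiwords k n) (mshift_multi k m \<beta>) (ket \<gamma>)) \<omega> =
    (if (\<omega>, \<gamma>) \<in> comparable_pairs k n \<and> s_map k (\<omega>, \<gamma>) = (\<alpha>, \<beta>)
     then complex_of_real (tau k m (\<omega>, \<gamma>)) else 0)"
proof -
  let ?L = "(\<forall>i\<in>{1..k}. prefix (\<beta> i) (\<gamma> i)) \<and> (\<forall>i\<in>{1..k}. prefix (\<alpha> i) (\<omega> i)) \<and>
      mdrop {1..k} \<alpha> \<omega> = mdrop {1..k} \<beta> \<gamma>"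
  let ?r = "\<lambda>\<alpha> \<omega> i. wratio (m i) (drop (length (\<alpha> i)) (\<omega> i)) (\<omega> i)"
  have "mshift_multi k m \<alpha> (ell2_adjoint (multiwords k n) (mshift_multi k m \<beta>) (ket \<gamma>)) \<omega> =
      (if ?L then complex_of_real ((\<Prod>i = 1..k. ?r \<alpha> \<omega> i) * (\<Prod>i = 1..k. ?r \<beta> \<gamma> i)) else 0)"
    unfolding ell2_adjoint_mshift_multi_ket[OF m \<gamma>] mshift_multi_apply[OF m]
    by (auto simp: ket_def)
  also have "\<dots> = (if ?L then complex_of_real (tau k m (\<omega>, \<gamma>)) else 0)"
  proof (rule if_cong[OF refl _ refl])
    assume L: ?L
    \<comment> \<open>In coordinate \<open>i\<close> both words share a remainder \<open>g\<close>,
      and membership in \<open>J_pairs\<close> makes one of the two prefixes empty.\<close>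
    have "?r \<alpha> \<omega> i * ?r \<beta> \<gamma> i = wratio (m i) (rmin (\<omega> i) (\<gamma> i)) (rmax (\<omega> i) (\<gamma> i))"
      if i: "i \<in> {1..k}" for i
    proof -
      have "mdrop {1..k} \<alpha> \<omega> i = mdrop {1..k} \<beta> \<gamma> i"
        using L by simp
      then have "drop (length (\<alpha> i)) (\<omega> i) = drop (length (\<beta> i)) (\<gamma> i)"
        using i by (simp add: mdrop_def)
      moreover have "prefix (\<alpha> i) (\<omega> i)" "prefix (\<beta> i) (\<gamma> i)"
        using L i by blast+
      ultimately obtain g where g: "\<omega> i = \<alpha> i @ g" "\<gamma> i = \<beta> i @ g"
        by (auto simp: prefix_def)
      then show ?thesis
        using wratio_rmin_rmax[of "\<alpha> i" "\<beta> i" "m i" g] J i m by (auto simp: J_pairs_mem)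
    qed
    then have "(\<Prod>i = 1..k. ?r \<alpha> \<omega> i * ?r \<beta> \<gamma> i) = tau k m (\<omega>, \<gamma>)"
      unfolding tau_def wratio_def prod.case by (intro prod.cong refl)
    then show "complex_of_real ((\<Prod>i = 1..k. ?r \<alpha> \<omega> i) * (\<Prod>i = 1..k. ?r \<beta> \<gamma> i)) =
        complex_of_real (tau k m (\<omega>, \<gamma>))"
      by (simp flip: prod.distrib)
  qed
  also have "?L \<longleftrightarrow> (\<omega>, \<gamma>) \<in> comparable_pairs k n \<and> s_map k (\<omega>, \<gamma>) = (\<alpha>, \<beta>)"
  proof (cases "\<omega> \<in> multiwords k n")
    case True
    then show ?thesis
      by (rule s_map_eq_iff[OF J _ \<gamma>])
  next
    case False
    \<comment> \<open>For \<omega> outside \<open>multiwords\<close> both sides are false: under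
      \<open>?L\<close> its letters come from \<alpha> and from the remainder of \<gamma>, and
      \<open>mdrop\<close> leaves it unchanged outside \<open>{1..k}\<close>.\<close>
    have "\<omega> \<in> multiwords k n" if L: ?L
      unfolding multiwords_mem
    proof (intro conjI ballI allI impI)
      have d: "mdrop {1..k} \<alpha> \<omega> \<in> multiwords k n"
        using L mdrop_multiwords[OF \<gamma>] by simp
      show "\<omega> i = undefined" if "i \<notin> {1..k}" for i
        using d that by (auto simp: multiwords_mem mdrop_def)
      show "\<omega> i \<in> words (n i)" if i: "i \<in> {1..k}" for i
      proof -
        have "prefix (\<alpha> i) (\<omega> i)"
          using L i by blast
        then obtain g where g: "\<omega> i = \<alpha> i @ g"
          by (auto simp: prefix_def)
        have "mdrop {1..k} \<alpha> \<omega> i \<in> words (n i)" "\<alpha> i \<in> words (n i)"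
          using d J i by (auto simp: multiwords_mem J_pairs_mem)
        then show ?thesis
          using g i by (simp add: mdrop_def)
      qed
    qed
    then show ?thesis
      using False by (auto simp: comparable_pairs_def)
  qed
  finally show ?thesis .
qed

lemma tau_pos:
  assumes "\<forall>i\<in>{1..k}. m i \<ge> 1"
  shows "tau k m (\<omega>, \<gamma>) > 0"
  unfolding tau_def prod.case using assms by (intro prod_pos) (simp add: wcoef_pos)

text \<open>Since \<open>op_tensor\<close> sums only over nonzero entries, \<open>A j 0 = 0\<close>
  is what makes the formula cover \<open>x = 0\<close> as well.\<close>

lemma fourier_term_ktensor_ket:
  assumes m: "\<forall>i\<in>{1..k}. m i \<ge> 1" and j: "j \<in> J_pairs k n"
    and \<gamma>: "\<gamma> \<in> multiwords k n" and A: "A j 0 = 0"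
  shows "fourier_term k m n A (ktensor x (ket \<gamma>)) j \<omega> =
    (if (\<omega>, \<gamma>) \<in> comparable_pairs k n \<and> s_map k (\<omega>, \<gamma>) = j
     then complex_of_real (tau k m (\<omega>, \<gamma>)) *\<^sub>C A j x else 0)"
proof -
  obtain \<alpha> \<beta> where ab: "j = (\<alpha>, \<beta>)"
    by (cases j)
  show ?thesis
    using A mshift_multi_adjoint_ket[OF m j[unfolded ab] \<gamma>, where \<omega> = \<omega>]
    unfolding fourier_term_def ab
    by (simp add: op_tensor_ktensor_ket[OF \<gamma>]) (simp add: ktensor_def)
qed

text \<open>By injectivity of \<open>s_map\<close> for fixed \<gamma>, the term has at most one
  nonzero coordinate.\<close>

lemma fourier_term_ktensor_ket_in_ell2:
  assumes m: "\<forall>i\<in>{1..k}. m i \<ge> 1" and j: "j \<in> J_pairs k n"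
    and \<gamma>: "\<gamma> \<in> multiwords k n" and A: "A j 0 = 0"
  shows "fourier_term k m n A (ktensor x (ket \<gamma>)) j \<in> ell2 (multiwords k n)"
proof (rule ell2_finite_support)
  let ?C = "{\<omega>. (\<omega>, \<gamma>) \<in> comparable_pairs k n}"
  let ?S = "{\<omega> \<in> ?C. s_map k (\<omega>, \<gamma>) = j}"
  have sub: "{\<omega>. fourier_term k m n A (ktensor x (ket \<gamma>)) j \<omega> \<noteq> 0} \<subseteq> ?S"
    using fourier_term_ktensor_ket[of k m j n \<gamma> A x, OF m j \<gamma> A] by (auto split: if_splits)
  have "finite ?S"
    by (rule inj_on_finite[of "\<lambda>\<omega>. s_map k (\<omega>, \<gamma>)" _ "{j}"])
      (auto intro: inj_on_subset[OF s_map_inj_on])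
  then show "finite {\<omega>. fourier_term k m n A (ktensor x (ket \<gamma>)) j \<omega> \<noteq> 0}"
    using sub by (rule rev_finite_subset)
  show "{\<omega>. fourier_term k m n A (ktensor x (ket \<gamma>)) j \<omega> \<noteq> 0} \<subseteq> multiwords k n"
    using sub by (auto simp: comparable_pairs_def)
qed

text \<open>A polynomial vector is the finite sum of its elementary tensors. Both \<open>T\<close>
  and each term of the series respect this sum, so convergence on elementary tensors
  suffices.\<close>

lemma fourier_represents_if_ket:
  assumes m: "\<forall>i\<in>{1..k}. m i \<ge> 1" and A: "\<forall>j\<in>J_pairs k n. A j 0 = 0"
    and T: "bounded_op_on (multiwords k n) T"
    and ket: "\<And>x \<gamma>. \<gamma> \<in> multiwords k n \<Longrightarrow>
      ell2_has_sum (fourier_term k m n A (ktensor x (ket \<gamma>))) (T (ktensor x (ket \<gamma>))) (J_pairs k n)"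
  shows "fourier_represents k m n A T"
  unfolding fourier_represents_def
proof
  fix p :: "multiword \<Rightarrow> 'a" assume p: "p \<in> poly_vectors k n"
  let ?I = "multiwords k n"
  define S where "S = {i \<in> ?I. p i \<noteq> 0}"
  define v where "v i = ktensor (p i) (ket i)" for i
  have S: "S \<subseteq> ?I" "finite S"
    using poly_vectors_finite_support[OF p] by (auto simp: S_def intro: finite_subset)
  have v: "v i \<in> ell2 ?I" if "i \<in> S" for i
    using that S by (auto simp: v_def ktensor_ket_in_ell2)
  have "p = (\<lambda>l. \<Sum>i\<in>S. v i l)"
  proof
    fix l
    have "(\<Sum>i\<in>S. v i l) = (\<Sum>i\<in>S. if l = i then p i else 0)"
      by (simp add: v_def ktensor_ket_apply)
    also have "\<dots> = p l"
      using poly_vectors_finite_support[OF p] S by (auto simp: S_def)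
    finally show "p l = (\<Sum>i\<in>S. v i l)" ..
  qed
  then have Tp: "T p = (\<lambda>l. \<Sum>i\<in>S. T (v i) l)"
    using bounded_op_on_sum[OF T, of S v] v by simp
  have terms: "fourier_term k m n A p j = (\<lambda>l. \<Sum>i\<in>S. fourier_term k m n A (v i) j l)"
    if "j \<in> J_pairs k n" for j
  proof -
    obtain \<alpha> \<beta> where ab: "j = (\<alpha>, \<beta>)"
      by (cases j)
    have "A (\<alpha>, \<beta>) 0 = 0"
      using A that ab by simp
    then have "fourier_term k m n A (v i) j = ktensor (A j (p i))
        ((mshift_multi k m \<alpha> \<circ> ell2_adjoint ?I (mshift_multi k m \<beta>)) (ket i))" if "i \<in> S" for i
      using that S op_tensor_ktensor_ket[of i ?I "A j"] by (auto simp: fourier_term_def v_def ab)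
    then show ?thesis
      by (simp add: fourier_term_def op_tensor_def ab S_def)
  qed
  have "ell2_has_sum (\<lambda>j l. \<Sum>i\<in>S. fourier_term k m n A (v i) j l) (\<lambda>l. \<Sum>i\<in>S. T (v i) l)
      (J_pairs k n)"
  proof (rule ell2_has_sum_sum[of _ _ _ _ ?I])
    fix i assume i: "i \<in> S"
    then show "ell2_has_sum (fourier_term k m n A (v i)) (T (v i)) (J_pairs k n)"
      using S ket by (auto simp: v_def)
    show "T (v i) \<in> ell2 ?I"
      using T v[OF i] by (simp add: bounded_op_on_def)
    show "fourier_term k m n A (v i) j \<in> ell2 ?I" if "j \<in> J_pairs k n" for j
      unfolding v_def
      by (rule fourier_term_ktensor_ket_in_ell2[OF m that]) (use i S bspec[OF A that] in auto)
  qed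
  then show "ell2_has_sum (fourier_term k m n A p) (T p) (J_pairs k n)"
    unfolding Tp using terms by (subst ell2_has_sum_cong) auto
qed

text \<open>At \<open>ktensor x (ket \<beta>)\<close>, a term can have a nonzero coordinate at
  \<sigma> only if its index is
  \<open>s_map k (\<sigma>, \<beta>) = (\<sigma>, \<beta>)\<close>.\<close>

lemma fourier_represents_coeff:
  assumes m: "\<forall>i\<in>{1..k}. m i \<ge> 1" and T: "bounded_op_on (multiwords k n) T"
    and A: "\<forall>j\<in>J_pairs k n. A j 0 = 0"
    and rep: "fourier_represents k m n A T" and j: "(\<sigma>, \<beta>) \<in> J_pairs k n"
  shows "T (ktensor x (ket \<beta>)) \<sigma> = complex_of_real (tau k m (\<sigma>, \<beta>)) *\<^sub>C A (\<sigma>, \<beta>) x"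
proof -
  let ?I = "multiwords k n"
  have \<beta>: "\<beta> \<in> ?I"
    using j by (simp add: J_pairs_mem)
  have coeff: "fourier_term k m n A (ktensor x (ket \<beta>)) j \<omega> =
      (if (\<omega>, \<beta>) \<in> comparable_pairs k n \<and> s_map k (\<omega>, \<beta>) = j
       then complex_of_real (tau k m (\<omega>, \<beta>)) *\<^sub>C A j x else 0)" if "j \<in> J_pairs k n" for j \<omega>
    by (rule fourier_term_ktensor_ket[OF m that \<beta>]) (use A that in blast)
  have "fourier_term k m n A (ktensor x (ket \<beta>)) (\<sigma>, \<beta>) \<sigma> = T (ktensor x (ket \<beta>)) \<sigma>"
  proof (rule ell2_has_sum_coordinate[OF _ _ _ j,
        where I = ?I and i = \<sigma> and u = "fourier_term k m n A (ktensor x (ket \<beta>))"])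
    show "ell2_has_sum (fourier_term k m n A (ktensor x (ket \<beta>))) (T (ktensor x (ket \<beta>))) (J_pairs k n)"
      using rep ktensor_ket_in_poly_vectors[OF \<beta>, of x] by (simp add: fourier_represents_def)
    show "fourier_term k m n A (ktensor x (ket \<beta>)) j' \<in> ell2 ?I" if "j' \<in> J_pairs k n" for j'
      by (rule fourier_term_ktensor_ket_in_ell2[OF m that \<beta>]) (use A that in blast)
    show "T (ktensor x (ket \<beta>)) \<in> ell2 ?I"
      using T ktensor_ket_in_ell2[OF \<beta>, of x] by (simp add: bounded_op_on_def)
    show "fourier_term k m n A (ktensor x (ket \<beta>)) j' \<sigma> = 0"
      if "j' \<in> J_pairs k n" "j' \<noteq> (\<sigma>, \<beta>)" for j'
      using that s_map_self[OF j] by (auto simp: coeff)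
  qed
  then show ?thesis
    using s_map_self[OF j] by (simp add: coeff j)
qed

theorem theorem3p6:
  fixes k :: nat and m n :: "nat \<Rightarrow> nat"
    and T :: "(multiword \<Rightarrow> 'a::chilbert_space) \<Rightarrow> (multiword \<Rightarrow> 'a)"
  assumes "k \<ge> 1"
    and "\<And>i. i \<in> {1..k} \<Longrightarrow> m i \<ge> 1"
    and "\<And>i. i \<in> {1..k} \<Longrightarrow> n i \<ge> 1"
    and "separable_space (euclidean :: 'a topology)"
    and "bounded_op_on (multiwords k n) T"
    and "multi_toeplitz k m n T"
  shows "\<exists>!A. A \<in> J_pairs k n \<rightarrow>\<^sub>E {B. bounded_clinear B} \<and> fourier_represents k m n A T"
proof -
  let ?I = "multiwords k n" and ?J = "J_pairs k n" and ?C = "comparable_pairs k n"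
  have m: "\<forall>i\<in>{1..k}. m i \<ge> 1"
    using assms(2) by blast
  note T = assms(5)
  obtain B where B: "\<And>p. p \<in> ?J \<Longrightarrow> bounded_clinear (B p)" and
    matrix: "\<And>\<omega> \<gamma> x y. \<omega> \<in> ?I \<Longrightarrow> \<gamma> \<in> ?I \<Longrightarrow>
      ell2_inner (T (ktensor x (multi_basis k n \<gamma>))) (ktensor y (multi_basis k n \<omega>)) =
        (if (\<omega>, \<gamma>) \<in> ?C
         then complex_of_real (tau k m (\<omega>, \<gamma>)) * cinner (B (s_map k (\<omega>, \<gamma>)) x) y else 0)"
    using assms(6) unfolding multi_toeplitz_def by metis
  have T_ell2: "T (ktensor x (ket \<gamma>)) \<in> ell2 ?I" if "\<gamma> \<in> ?I" for x \<gamma>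
    using T ktensor_ket_in_ell2[OF that, of x] by (simp add: bounded_op_on_def)
  \<comment> \<open>The Toeplitz condition gives scalar products with all \<open>y\<close>, which
    determine the coordinate as a vector; outside the index set both sides are 0.\<close>
  have coord: "T (ktensor x (ket \<gamma>)) \<omega> =
      (if (\<omega>, \<gamma>) \<in> ?C
       then complex_of_real (tau k m (\<omega>, \<gamma>)) *\<^sub>C B (s_map k (\<omega>, \<gamma>)) x else 0)"
    if \<gamma>: "\<gamma> \<in> ?I" for x \<gamma> \<omega>
  proof (cases "\<omega> \<in> ?I")
    case True
    show ?thesis
    proof (rule cinner_ext)
      fix y
      show "cinner (T (ktensor x (ket \<gamma>)) \<omega>) y = cinner (if (\<omega>, \<gamma>) \<in> ?C
          then complex_of_real (tau k m (\<omega>, \<gamma>)) *\<^sub>C B (s_map k (\<omega>, \<gamma>)) x else 0) y"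
        using matrix[OF True \<gamma>, of x y]
        by (simp add: multi_basis_eq_ket True \<gamma> ell2_inner_ktensor_ket cinner_scaleC_left)
    qed
  next
    case False
    then show ?thesis
      using T_ell2[OF \<gamma>, of x] by (auto simp: ell2_def comparable_pairs_def)
  qed
  have zero: "\<forall>j\<in>?J. A j 0 = 0" if "A \<in> ?J \<rightarrow>\<^sub>E {B. bounded_clinear B}" for A
    using that bounded_clinear_zero by blast
  \<comment> \<open>The Toeplitz symbols themselves are the Fourier coefficients; restriction to
    \<open>J_pairs\<close> fixes the values elsewhere, as uniqueness of a function requires.\<close>
  let ?A = "restrict B ?J"
  have A: "?A \<in> ?J \<rightarrow>\<^sub>E {B. bounded_clinear B}"
    using B by auto
  have rep: "fourier_represents k m n ?A T"
  proof (rule fourier_represents_if_ket[where A = ?A and T = T, OF m zero[OF A] T])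
    fix x :: 'a and \<gamma> assume \<gamma>: "\<gamma> \<in> ?I"
    show "ell2_has_sum (fourier_term k m n ?A (ktensor x (ket \<gamma>))) (T (ktensor x (ket \<gamma>))) ?J"
    \<comment> \<open>The coordinates of \<open>T (ktensor x (ket \<gamma>))\<close> are relabelled
      by \<open>\<omega> \<mapsto> s_map k (\<omega>, \<gamma>)\<close> on the words comparable with
      \<gamma>.\<close>
    proof (rule ell2_has_sum_coordinates[OF T_ell2[OF \<gamma>] s_map_inj_on[of k \<gamma> n]])
      show "(\<lambda>\<omega>. s_map k (\<omega>, \<gamma>)) ` {\<omega>. (\<omega>, \<gamma>) \<in> ?C} \<subseteq> ?J"
        using s_map_in_J_pairs by blast
      show "T (ktensor x (ket \<gamma>)) \<omega> = 0" if "\<omega> \<notin> {\<omega>. (\<omega>, \<gamma>) \<in> ?C}" for \<omega>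
        using that by (simp add: coord[OF \<gamma>])
      show "fourier_term k m n ?A (ktensor x (ket \<gamma>)) j \<omega> =
          (if \<omega> \<in> {\<omega>. (\<omega>, \<gamma>) \<in> ?C} \<and> s_map k (\<omega>, \<gamma>) = j
           then T (ktensor x (ket \<gamma>)) \<omega> else 0)" if "j \<in> ?J" for j \<omega>
        using fourier_term_ktensor_ket[of k m j n \<gamma> ?A x \<omega>, OF m that \<gamma>] zero[OF A] that
        by (auto simp: coord[OF \<gamma>])
    qed
  qed
  show ?thesis
  proof (rule ex1I[of _ ?A])
    show "?A \<in> ?J \<rightarrow>\<^sub>E {B. bounded_clinear B} \<and> fourier_represents k m n ?A T"
      using A rep by blast
    fix A' assume A': "A' \<in> ?J \<rightarrow>\<^sub>E {B. bounded_clinear B} \<and> fourier_represents k m n A' T"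
    show "A' = ?A"
    proof (rule PiE_ext[OF conjunct1[OF A'] A])
      fix j assume j: "j \<in> ?J"
      obtain \<sigma> \<beta> where sb: "j = (\<sigma>, \<beta>)"
        by (cases j)
      show "A' j = ?A j"
      proof
        fix x
        let ?t = "complex_of_real (tau k m (\<sigma>, \<beta>))"
        have coeff: "T (ktensor x (ket \<beta>)) \<sigma> = ?t *\<^sub>C A j x"
          if "A \<in> ?J \<rightarrow>\<^sub>E {B. bounded_clinear B} \<and> fourier_represents k m n A T" for A
          using that j unfolding sb by (intro fourier_represents_coeff[OF m T zero]) auto
        \<comment> \<open>Both families represent \<open>T\<close>, so both sides equal the same
          coordinate of \<open>T (ktensor x (ket \<beta>))\<close>.\<close>
        have "?t *\<^sub>C A' j x = ?t *\<^sub>C ?A j x"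
          using coeff[OF A'] coeff[OF conjI[OF A rep]] by simp
        moreover have "?t \<noteq> 0"
          using tau_pos[OF m, of \<sigma> \<beta>] by simp
        ultimately show "A' j x = ?A j x"
          using scaleC_left_cancel by blast
      qed
    qed
  qed
qed

end
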